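(* Fix $k>0$. For $u=s+it$ with $s\ge0$, $t>0$ and $s^2+t^2=kt$, let $L_u$ be the operator in $L^2((0,\pi),\mathbb{C}^2)$ defined in the context. Then no two of the operators $L_u$ are similar: if $u\ne\tilde u$ are two such parameters, then $L_u$ and $L_{\tilde u}$ are not similar.
   Context: $L_u$ is defined by $(L_uf)_1(x)=uf_1'(x)$, $(L_uf)_2(x)=\overline{u}f_2'(x)$ for all $f\in W^{1,2}((0,\pi),\mathbb{C}^2)$ subject to the boundary conditions $f_1(0)=f_2(0)$ and $f_1(\pi)=f_2(\pi)$. Two operators $L,\tilde L$ are similar if $\tilde L=TLT^{-1}$ (including equality of domains) for some bounded operator $T$ with bounded inverse. *)

theory Defs
  imports "HOL-Analysis.Analysis"
begin

section \<open>The Hilbert space \<open>L\<^sup>2((0,\<pi>), \<complex>\<^sup>2)\<close>\<close>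

abbreviation M0pi :: "real measure" where
  "M0pi \<equiv> lebesgue_on {0<..<pi}"

definition square_integrable :: "(real \<Rightarrow> complex ^ 2) \<Rightarrow> bool" where
  "square_integrable f \<longleftrightarrow>
     f \<in> borel_measurable M0pi \<and> integrable M0pi (\<lambda>x. (norm (f x))\<^sup>2)"

definition l2_eq :: "(real \<Rightarrow> complex ^ 2) \<Rightarrow> (real \<Rightarrow> complex ^ 2) \<Rightarrow> bool" where
  "l2_eq f g \<longleftrightarrow> square_integrable f \<and> square_integrable g \<and> (AE x in M0pi. f x = g x)"

lemma square_integrable_zero: "square_integrable (\<lambda>_. 0)"
  by (simp add: square_integrable_def)

lemma square_integrable_dominated:
  assumes "h \<in> borel_measurable M0pi" and "integrable M0pi b"
    and "\<And>x. (norm (h x))\<^sup>2 \<le> b x"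
  shows "square_integrable h"
  unfolding square_integrable_def
proof
  show "integrable M0pi (\<lambda>x. (norm (h x))\<^sup>2)"
  proof (rule Bochner_Integration.integrable_bound[OF assms(2)])
    show "(\<lambda>x. (norm (h x))\<^sup>2) \<in> borel_measurable M0pi"
      using assms(1) by measurable
    show "AE x in M0pi. norm ((norm (h x))\<^sup>2) \<le> norm (b x)"
      using assms(3) by (intro AE_I2) (simp add: order.trans[OF _ abs_ge_self])
  qed
qed (fact assms(1))

lemma square_integrable_add:
  assumes "square_integrable f" "square_integrable g"
  shows "square_integrable (\<lambda>x. f x + g x)"
proof (rule square_integrable_dominated)
  show "integrable M0pi (\<lambda>x. 2 * (norm (f x))\<^sup>2 + 2 * (norm (g x))\<^sup>2)"
    using assms by (simp add: square_integrable_def)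
  show "(norm (f x + g x))\<^sup>2 \<le> 2 * (norm (f x))\<^sup>2 + 2 * (norm (g x))\<^sup>2" for x
  proof -
    have "(norm (f x + g x))\<^sup>2 \<le> (norm (f x) + norm (g x))\<^sup>2"
      by (intro power_mono norm_triangle_ineq) simp
    also have "\<dots> \<le> 2 * (norm (f x))\<^sup>2 + 2 * (norm (g x))\<^sup>2"
      using sum_squares_bound[of "norm (f x)" "norm (g x)"] by (simp add: power2_sum)
    finally show ?thesis .
  qed
  show "(\<lambda>x. f x + g x) \<in> borel_measurable M0pi"
    using assms by (intro borel_measurable_add) (simp_all add: square_integrable_def)
qed

lemma square_integrable_linear:
  assumes "bounded_linear A" "square_integrable f"
  shows "square_integrable (\<lambda>x. A (f x))"
proof -
  obtain K where K: "\<And>v. norm (A v) \<le> norm v * K"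
    using bounded_linear.bounded[OF assms(1)] by blast
  have f: "f \<in> borel_measurable M0pi"
    using assms(2) by (simp add: square_integrable_def)
  show ?thesis
  proof (rule square_integrable_dominated)
    show "integrable M0pi (\<lambda>x. K\<^sup>2 * (norm (f x))\<^sup>2)"
      using assms(2) by (simp add: square_integrable_def)
    show "(norm (A (f x)))\<^sup>2 \<le> K\<^sup>2 * (norm (f x))\<^sup>2" for x
      using power_mono[OF K[of "f x"] norm_ge_zero, of 2]
      by (simp add: power_mult_distrib mult.commute)
    show "(\<lambda>x. A (f x)) \<in> borel_measurable M0pi"
      by (rule borel_measurable_continuous_on[OF _ f])
        (rule linear_continuous_on[OF assms(1)])
  qed
qed

lemma integrable_inner_l2:
  assumes "square_integrable f" "square_integrable g"
  shows "integrable M0pi (\<lambda>x. f x \<bullet> g x)"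
proof (rule Bochner_Integration.integrable_bound)
  show "integrable M0pi (\<lambda>x. (norm (f x))\<^sup>2 + (norm (g x))\<^sup>2)"
    using assms by (simp add: square_integrable_def)
  have "f \<in> borel_measurable M0pi" "g \<in> borel_measurable M0pi"
    using assms by (simp_all add: square_integrable_def)
  then show "(\<lambda>x. f x \<bullet> g x) \<in> borel_measurable M0pi"
    by (rule borel_measurable_inner)
  have "\<bar>f x \<bullet> g x\<bar> \<le> (norm (f x))\<^sup>2 + (norm (g x))\<^sup>2" for x
    using Cauchy_Schwarz_ineq2[of "f x" "g x"] sum_squares_bound[of "norm (f x)" "norm (g x)"]
      mult_nonneg_nonneg[OF norm_ge_zero[of "f x"] norm_ge_zero[of "g x"]] by linarith
  then show "AE x in M0pi. norm (f x \<bullet> g x) \<le> norm ((norm (f x))\<^sup>2 + (norm (g x))\<^sup>2)"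
    by (intro AE_I2) simp
qed

quotient_type l2 = "real \<Rightarrow> complex ^ 2" / partial: l2_eq
  morphisms rep_l2 abs_l2
proof (rule part_equivpI)
  show "\<exists>f. l2_eq f f"
    using square_integrable_zero by (auto simp: l2_eq_def)
  show "symp l2_eq"
    by (auto simp: symp_def l2_eq_def elim: AE_mp)
  show "transp l2_eq"
    unfolding transp_def l2_eq_def by (auto elim: AE_mp)
qed

instantiation l2 :: real_vector
begin

lift_definition zero_l2 :: l2 is "\<lambda>_. 0"
  by (simp add: l2_eq_def square_integrable_zero)

lift_definition plus_l2 :: "l2 \<Rightarrow> l2 \<Rightarrow> l2" is "\<lambda>f g x. f x + g x"
  by (auto simp: l2_eq_def intro: square_integrable_add)

lift_definition uminus_l2 :: "l2 \<Rightarrow> l2" is "\<lambda>f x. - f x"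
  by (auto simp: l2_eq_def
      intro!: square_integrable_linear[OF bounded_linear_minus[OF bounded_linear_ident]])

definition minus_l2 :: "l2 \<Rightarrow> l2 \<Rightarrow> l2" where
  "minus_l2 f g = f + (- g)"

lift_definition scaleR_l2 :: "real \<Rightarrow> l2 \<Rightarrow> l2" is "\<lambda>r f x. r *\<^sub>R f x"
  by (auto simp: l2_eq_def intro: square_integrable_linear bounded_linear_scaleR_right)

instance
proof
  fix f g h :: l2 and a b :: real
  show "f + g + h = f + (g + h)"
    by transfer (auto simp: l2_eq_def add.assoc intro!: square_integrable_add)
  show "f + g = g + f"
    by transfer (auto simp: l2_eq_def add.commute intro!: square_integrable_add)
  show "0 + f = f"
    by transfer (auto simp: l2_eq_def)
  show "- f + f = 0"
    by transfer (auto simp: l2_eq_def square_integrable_zero)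
  show "f - g = f + - g"
    by (fact minus_l2_def)
  show "a *\<^sub>R (f + g) = a *\<^sub>R f + a *\<^sub>R g"
    by transfer (auto simp: l2_eq_def scaleR_add_right
        intro!: square_integrable_add square_integrable_linear[OF bounded_linear_scaleR_right])
  show "(a + b) *\<^sub>R f = a *\<^sub>R f + b *\<^sub>R f"
    by transfer (auto simp: l2_eq_def scaleR_add_left
        intro!: square_integrable_add square_integrable_linear[OF bounded_linear_scaleR_right])
  show "a *\<^sub>R b *\<^sub>R f = (a * b) *\<^sub>R f"
    by transfer (auto simp: l2_eq_def
        intro!: square_integrable_linear[OF bounded_linear_scaleR_right])
  show "1 *\<^sub>R f = f"
    by transfer (auto simp: l2_eq_def)
qed

end

text \<open>The real inner product is the real part of the usual sesquilinear one, hence it induces the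
  usual norm \<open>\<parallel>f\<parallel>\<^sup>2 = \<integral> \<bar>f\<^sub>1\<bar>\<^sup>2 + \<bar>f\<^sub>2\<bar>\<^sup>2\<close>.\<close>

instantiation l2 :: real_inner
begin

lift_definition inner_l2 :: "l2 \<Rightarrow> l2 \<Rightarrow> real" is "\<lambda>f g. LINT x|M0pi. f x \<bullet> g x"
proof -
  fix f f' g g' assume "l2_eq f f'" "l2_eq g g'"
  then show "(LINT x|M0pi. f x \<bullet> g x) = (LINT x|M0pi. f' x \<bullet> g' x)"
    unfolding l2_eq_def
    by (intro integral_cong_AE borel_measurable_integrable integrable_inner_l2) auto
qed

definition norm_l2 :: "l2 \<Rightarrow> real" where
  "norm_l2 f = sqrt (f \<bullet> f)"

definition dist_l2 :: "l2 \<Rightarrow> l2 \<Rightarrow> real" where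
  "dist_l2 f g = norm (f - g)"

definition sgn_l2 :: "l2 \<Rightarrow> l2" where
  "sgn_l2 f = f /\<^sub>R norm f"

definition uniformity_l2 :: "(l2 \<times> l2) filter" where
  "uniformity_l2 = (INF e\<in>{0<..}. principal {(x, y). dist x y < e})"

definition open_l2 :: "l2 set \<Rightarrow> bool" where
  "open_l2 U \<longleftrightarrow> (\<forall>x\<in>U. eventually (\<lambda>(x', y). x' = x \<longrightarrow> y \<in> U) uniformity)"

instance
proof
  fix f g h :: l2 and a :: real
  show "sgn f = f /\<^sub>R norm f"
    by (fact sgn_l2_def)
  show "dist f g = norm (f - g)"
    by (fact dist_l2_def)
  show "uniformity = (INF e\<in>{0<..}. principal {(x :: l2, y). dist x y < e})"
    by (fact uniformity_l2_def)
  show "open U \<longleftrightarrow> (\<forall>x\<in>U. eventually (\<lambda>(x', y). x' = x \<longrightarrow> y \<in> U) uniformity)" for U :: "l2 set"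
    by (fact open_l2_def)
  show "f \<bullet> g = g \<bullet> f"
    by transfer (simp add: inner_commute)
  show "(f + g) \<bullet> h = f \<bullet> h + g \<bullet> h"
    by transfer (simp add: l2_eq_def inner_add_left integrable_inner_l2)
  show "(a *\<^sub>R f) \<bullet> g = a * (f \<bullet> g)"
    by transfer simp
  show "0 \<le> f \<bullet> f"
    by transfer simp
  show "f \<bullet> f = 0 \<longleftrightarrow> f = 0"
  proof transfer
    fix f assume "l2_eq f f"
    then have f: "square_integrable f"
      by (simp add: l2_eq_def)
    have "(LINT x|M0pi. f x \<bullet> f x) = 0 \<longleftrightarrow> (AE x in M0pi. f x \<bullet> f x = 0)"
      by (rule integral_nonneg_eq_0_iff_AE[OF integrable_inner_l2[OF f f]]) simp
    then show "(LINT x|M0pi. f x \<bullet> f x) = 0 \<longleftrightarrow> l2_eq f (\<lambda>_. 0)"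
      using f by (simp add: l2_eq_def square_integrable_zero)
  qed
  show "norm f = sqrt (f \<bullet> f)"
    by (fact norm_l2_def)
qed

end

lemma bounded_linear_vector_scalar_mult: "bounded_linear (\<lambda>v :: complex ^ 2. c *s v)"
  by (rule linear_conv_bounded_linear[THEN iffD1], rule linearI)
    (simp_all add: vec_eq_iff algebra_simps)

lemma bounded_linear_diag:
  "bounded_linear (\<lambda>v :: complex ^ 2. vector [a * v $ 1, b * v $ 2] :: complex ^ 2)"
  by (rule linear_conv_bounded_linear[THEN iffD1], rule linearI)
    (simp_all add: vec_eq_iff forall_2 algebra_simps)

lift_definition cscale :: "complex \<Rightarrow> l2 \<Rightarrow> l2" is "\<lambda>c f x. c *s f x"
  by (auto simp: l2_eq_def intro: square_integrable_linear[OF bounded_linear_vector_scalar_mult])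

lift_definition diag_mult :: "complex \<Rightarrow> complex \<Rightarrow> l2 \<Rightarrow> l2" is
  "\<lambda>a b f x. vector [a * f x $ 1, b * f x $ 2]"
  by (auto simp: l2_eq_def intro: square_integrable_linear[OF bounded_linear_diag])


section \<open>The Sobolev space \<open>W\<^sup>1\<^sup>,\<^sup>2((0,\<pi>), \<complex>\<^sup>2)\<close>\<close>

text \<open>Real-valued test functions give the same weak derivatives as complex-valued ones.\<close>

definition test_function :: "(real \<Rightarrow> real) \<Rightarrow> bool" where
  "test_function \<phi> \<longleftrightarrow>
     (\<forall>n x. (deriv ^^ n) \<phi> field_differentiable (at x)) \<and>
     (\<exists>K. compact K \<and> K \<subseteq> {0<..<pi} \<and> (\<forall>x. x \<notin> K \<longrightarrow> \<phi> x = 0))"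

lemma test_function_measurable:
  assumes "test_function \<phi>"
  shows "\<phi> \<in> borel_measurable M0pi" and "deriv \<phi> \<in> borel_measurable M0pi"
proof -
  have "continuous_on UNIV ((deriv ^^ n) \<phi>)" for n
    using assms unfolding test_function_def
    by (simp add: continuous_at_imp_continuous_on field_differentiable_imp_continuous_at)
  then have "(deriv ^^ n) \<phi> \<in> borel_measurable M0pi" for n
    by (auto intro!: measurable_restrict_space1 measurable_completion
        borel_measurable_continuous_onI)
  from this[of 0] this[of 1] show "\<phi> \<in> borel_measurable M0pi" "deriv \<phi> \<in> borel_measurable M0pi"
    by simp_all
qed

text \<open>\<open>has_weak_derivative f g\<close>: the distributional derivative of \<open>f\<close> is the \<open>L\<^sup>2\<close> function \<open>g\<close>;
  thus \<open>f\<close> is in \<open>W\<^sup>1\<^sup>,\<^sup>2\<close> iff such a \<open>g\<close> exists.\<close>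

lift_definition has_weak_derivative :: "l2 \<Rightarrow> l2 \<Rightarrow> bool" is
  "\<lambda>f g. \<forall>\<phi>. test_function \<phi> \<longrightarrow>
     (LINT x|M0pi. deriv \<phi> x *\<^sub>R f x) = - (LINT x|M0pi. \<phi> x *\<^sub>R g x)"
proof -
  fix f f' g g' assume *: "l2_eq f f'" "l2_eq g g'"
  have "(LINT x|M0pi. deriv \<phi> x *\<^sub>R f x) = (LINT x|M0pi. deriv \<phi> x *\<^sub>R f' x)"
    "(LINT x|M0pi. \<phi> x *\<^sub>R g x) = (LINT x|M0pi. \<phi> x *\<^sub>R g' x)" if "test_function \<phi>" for \<phi>
    using * test_function_measurable[OF that]
    unfolding l2_eq_def square_integrable_def
    by (auto intro!: integral_cong_AE borel_measurable_scaleR)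
  then show "(\<forall>\<phi>. test_function \<phi> \<longrightarrow>
      (LINT x|M0pi. deriv \<phi> x *\<^sub>R f x) = - (LINT x|M0pi. \<phi> x *\<^sub>R g x)) \<longleftrightarrow>
    (\<forall>\<phi>. test_function \<phi> \<longrightarrow>
      (LINT x|M0pi. deriv \<phi> x *\<^sub>R f' x) = - (LINT x|M0pi. \<phi> x *\<^sub>R g' x))"
    by simp
qed

definition W12 :: "l2 set" where
  "W12 = {f. \<exists>g. has_weak_derivative f g}"

text \<open>Point values of a Sobolev function, in particular those at the endpoints, are the values of
  its representative that is continuous on \<open>[0,\<pi>]\<close>.\<close>

lift_definition continuous_representative :: "l2 \<Rightarrow> (real \<Rightarrow> complex ^ 2) \<Rightarrow> bool" is
  "\<lambda>f F. continuous_on {0..pi} F \<and> (AE x in M0pi. f x = F x)"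
  unfolding l2_eq_def by (auto elim: AE_mp)


section \<open>The operators \<open>L\<^sub>u\<close> and similarity\<close>

text \<open>An unbounded operator is represented by its graph, so that equality of operators includes
  equality of their domains.\<close>

definition L_domain :: "l2 set" where
  "L_domain = {f \<in> W12. \<exists>F. continuous_representative f F \<and>
     F 0 $ 1 = F 0 $ 2 \<and> F pi $ 1 = F pi $ 2}"

definition L_op :: "complex \<Rightarrow> (l2 \<times> l2) set" where
  "L_op u = {(f, diag_mult u (cnj u) f') | f f'. f \<in> L_domain \<and> has_weak_derivative f f'}"

definition bounded_clinear :: "(l2 \<Rightarrow> l2) \<Rightarrow> bool" where
  "bounded_clinear T \<longleftrightarrow> bounded_linear T \<and> (\<forall>c f. T (cscale c f) = cscale c (T f))"

text \<open>The last conjunct says that \<open>L'\<close> is the graph of \<open>T L T\<^sup>-\<^sup>1\<close>, where \<open>S = T\<^sup>-\<^sup>1\<close>.\<close>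

definition similar_ops :: "(l2 \<times> l2) set \<Rightarrow> (l2 \<times> l2) set \<Rightarrow> bool" where
  "similar_ops L L' \<longleftrightarrow>
     (\<exists>T S. bounded_clinear T \<and> bounded_clinear S \<and> S \<circ> T = id \<and> T \<circ> S = id \<and>
        L' = {(g, T h) | g h. (S g, h) \<in> L})"

end

theory Submission
  imports Defs "HOL-Real_Asymp.Real_Asymp"
begin

text \<open>
  All the operators \<open>L\<^sub>u\<close> have the same simple eigenvalues: with \<open>1/u = (r - \<i>)/k\<close>, where
  \<open>r = Re u / Im u\<close>, the numbers \<open>k n\<close> are eigenvalues with eigenfunctions
  \<open>e\<^sub>n = (exp (n (r - \<i>) x), exp (n (r + \<i>) x))\<close>. Similarity also preserves, up to a constant factor,
  the conditioning of the eigenvalues, that is, the norms of the spectral projections, or equivalently how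
  close the normalised \<open>e\<^sub>n\<close> is to the range of \<open>L\<^sub>u - k n\<close>. The eigenfunctions of the adjoint are the
  reciprocal exponentials, so that this distance behaves like \<open>exp (- n r \<pi>)\<close> up to powers of \<open>n\<close>. Hence \<open>r\<close>
  is a similarity invariant, and \<open>r\<close> determines \<open>u\<close>.

  Let \<open>r < r'\<close> and let \<open>T\<close>, with inverse \<open>S\<close>, transform \<open>L\<^sub>u\<close> into \<open>L\<^sub>u\<^sub>'\<close>. The proof combines three
  estimates. An explicit function in the domain shows that \<open>e'\<^sub>n\<close> lies within \<open>O(n)\<close> of the range of
  \<open>L\<^sub>u\<^sub>' - k n\<close> (\<open>exp_pair_near_range\<close>), and \<open>S\<close> carries this over to \<open>S e'\<^sub>n\<close> and \<open>L\<^sub>u\<close>. Next,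
  \<open>S e'\<^sub>n = c e\<^sub>n\<close> because eigenspaces are one-dimensional (\<open>L_op_eigenvector\<close>). Finally, the bounded functional
  that kills the range of \<open>L\<^sub>u - k n\<close> takes a value independent of \<open>n\<close> at \<open>e\<^sub>n\<close> (\<open>annihilator_range\<close>,
  \<open>inner_exp_pair_annihilator\<close>), so \<open>c = O(n)\<close>. Therefore the norm of \<open>e'\<^sub>n\<close> is
  \<open>O(n)\<close> times that of \<open>e\<^sub>n\<close>, which contradicts \<open>r < r'\<close> as \<open>n\<close> grows.

  The two facts about arbitrary elements of the domain, \<open>L_op_eigenvector\<close> and \<open>annihilator_range\<close>,
  rest on the fundamental theorem of calculus for weak derivatives up to the boundary
  (\<open>weak_derivative_increment\<close>), obtained by testing with smooth cut-offs.
\<close>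

section \<open>Smooth step functions\<close>

text \<open>Differentiability up to a finite order, with the derivative as an existential witness, so that
  closure under the usual operations follows by induction on the order; iterated \<^const>\<open>deriv\<close>
  of a product or a reciprocal would have to be computed instead.\<close>

primrec differentiable_times :: "nat \<Rightarrow> (real \<Rightarrow> real) \<Rightarrow> bool" where
  "differentiable_times 0 f \<longleftrightarrow> True"
| "differentiable_times (Suc n) f \<longleftrightarrow>
     (\<exists>f'. (\<forall>x. (f has_real_derivative f' x) (at x)) \<and> differentiable_times n f')"

lemma differentiable_times_Suc_D: "differentiable_times (Suc n) f \<Longrightarrow> differentiable_times n f"
proof (induction n arbitrary: f)
  case (Suc n)
  then show ?case by (metis differentiable_times.simps(2))
qed simp

lemma differentiable_times_SucI:
  "(\<And>x. (f has_real_derivative f' x) (at x)) \<Longrightarrow> differentiable_times n f' \<Longrightarrow>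
    differentiable_times (Suc n) f"
  by auto

lemma differentiable_times_const: "differentiable_times n (\<lambda>x. c)"
  by (induction n arbitrary: c) (auto intro!: exI[of _ "\<lambda>x. 0"])

lemma differentiable_times_add:
  "differentiable_times n f \<Longrightarrow> differentiable_times n g \<Longrightarrow> differentiable_times n (\<lambda>x. f x + g x)"
proof (induction n arbitrary: f g)
  case (Suc n)
  from Suc.prems obtain f' g' where
    f: "\<And>x. (f has_real_derivative f' x) (at x)" "differentiable_times n f'" and
    g: "\<And>x. (g has_real_derivative g' x) (at x)" "differentiable_times n g'"
    by auto
  show ?case
    using f g by (auto intro!: exI[of _ "\<lambda>x. f' x + g' x"] derivative_intros Suc.IH)
qed simp

lemma differentiable_times_mult:
  "differentiable_times n f \<Longrightarrow> differentiable_times n g \<Longrightarrow> differentiable_times n (\<lambda>x. f x * g x)"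
proof (induction n arbitrary: f g)
  case (Suc n)
  from Suc.prems obtain f' g' where
    f: "\<And>x. (f has_real_derivative f' x) (at x)" "differentiable_times n f'" and
    g: "\<And>x. (g has_real_derivative g' x) (at x)" "differentiable_times n g'"
    by auto
  have "differentiable_times n f" "differentiable_times n g"
    using Suc.prems by (auto dest: differentiable_times_Suc_D simp del: differentiable_times.simps)
  then have "differentiable_times n (\<lambda>x. f' x * g x + f x * g' x)"
    using f g by (intro differentiable_times_add Suc.IH)
  moreover have "((\<lambda>x. f x * g x) has_real_derivative f' x * g x + f x * g' x) (at x)" for x
    using f g by (auto intro!: derivative_eq_intros)
  ultimately show ?case by (rule differentiable_times_SucI[rotated])
qed simp

lemma differentiable_times_inverse:
  assumes "\<And>x. f x \<noteq> 0"
  shows "differentiable_times n f \<Longrightarrow> differentiable_times n (\<lambda>x. inverse (f x))"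
proof (induction n)
  case (Suc n)
  from Suc.prems obtain f' where
    f: "\<And>x. (f has_real_derivative f' x) (at x)" "differentiable_times n f'"
    by auto
  have inv: "differentiable_times n (\<lambda>x. inverse (f x))"
    using Suc.prems by (intro Suc.IH) (rule differentiable_times_Suc_D)
  have "differentiable_times n (\<lambda>x. (-1) * (f' x * (inverse (f x) * inverse (f x))))"
    by (intro differentiable_times_mult differentiable_times_const inv f)
  moreover have "((\<lambda>x. inverse (f x)) has_real_derivative
      (-1) * (f' x * (inverse (f x) * inverse (f x)))) (at x)" for x
    using f assms by (auto intro!: derivative_eq_intros simp: power2_eq_square field_simps)
  ultimately show ?case by (rule differentiable_times_SucI[rotated])
qed simp

lemma differentiable_times_compose_affine:
  "differentiable_times n f \<Longrightarrow> differentiable_times n (\<lambda>x. f (c * x + d))"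
proof (induction n arbitrary: f)
  case (Suc n)
  from Suc.prems obtain f' where
    f: "\<And>x. (f has_real_derivative f' x) (at x)" "differentiable_times n f'"
    by auto
  have "differentiable_times n (\<lambda>x. c * f' (c * x + d))"
    using f by (intro differentiable_times_mult differentiable_times_const Suc.IH)
  moreover have "((\<lambda>x. f (c * x + d)) has_real_derivative c * f' (c * x + d)) (at x)" for x
  proof -
    have "((\<lambda>x. c * x + d) has_real_derivative c) (at x)"
      by (auto intro!: derivative_eq_intros)
    from DERIV_chain2[OF f(1) this] show ?thesis by (simp add: mult.commute)
  qed
  ultimately show ?case by (rule differentiable_times_SucI[rotated])
qed simp

text \<open>The passage back to iterated derivatives, the form in which test functions are required to be
  smooth.\<close>

lemma differentiable_times_imp_deriv:
  assumes "\<And>n. differentiable_times n f"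
  shows "(deriv ^^ n) f field_differentiable (at x)"
proof -
  have "differentiable_times (Suc m) f \<Longrightarrow>
      differentiable_times (Suc m - n) ((deriv ^^ n) f)" if "n \<le> m" for m n
    using that
  proof (induction n)
    case (Suc n)
    then have "differentiable_times (Suc (m - n)) ((deriv ^^ n) f)"
      by (simp add: Suc_diff_le)
    then obtain f' where f': "\<And>x. ((deriv ^^ n) f has_real_derivative f' x) (at x)"
      "differentiable_times (m - n) f'" by auto
    then have "(deriv ^^ Suc n) f = f'"
      by (auto simp: fun_eq_iff intro!: DERIV_imp_deriv)
    with f' show ?case by simp
  qed simp
  from this[of n n] assms[of "Suc n"]
  have "differentiable_times (Suc 0) ((deriv ^^ n) f)" by simp
  then show ?thesis by (auto simp: field_differentiable_def)
qed

text \<open>The classical function \<open>exp (-1/x)\<close>, flat at the origin, with a polynomial factor in \<open>1/x\<close>: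
  this family is closed under differentiation, so smoothness needs only first derivatives.\<close>

definition flat :: "real poly \<Rightarrow> real \<Rightarrow> real" where
  "flat q x = (if x \<le> 0 then 0 else poly q (1 / x) * exp (- (1 / x)))"

lemma poly_times_exp_minus_tendsto_0:
  fixes q :: "real poly"
  shows "((\<lambda>x. poly q x * exp (- x)) \<longlongrightarrow> 0) at_top"
proof -
  have "((\<lambda>x. \<Sum>i\<le>degree q. coeff q i * (x ^ i / exp x)) \<longlongrightarrow> (\<Sum>i\<le>degree q. coeff q i * 0)) at_top"
    by (intro tendsto_intros tendsto_power_div_exp_0)
  then show ?thesis
    by (simp add: poly_altdef sum_distrib_right exp_minus divide_inverse mult.assoc)
qed

text \<open>Away from the origin this is the chain rule with \<open>y = 1/x\<close>, \<open>dy/dx = - y\<^sup>2\<close>, which accounts for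
  the factor \<^term>\<open>[:0, 0, 1:]\<close>. At the origin the difference quotient from the right is again a
  polynomial in \<open>y\<close> times \<open>exp (-y)\<close> as \<open>y\<close> tends to infinity.\<close>

lemma flat_has_derivative:
  "(flat q has_real_derivative flat ((q - pderiv q) * [:0, 0, 1:]) x) (at x)"
proof -
  consider "x < 0" | "x = 0" | "x > 0" by linarith
  then show ?thesis
  proof cases
    assume x: "x < 0"
    have "((\<lambda>x. 0) has_real_derivative 0) (at x)" by simp
    then have "(flat q has_real_derivative 0) (at x)"
      by (rule has_field_derivative_transform_within_open[where S="{..<0}"]) (use x in \<open>auto simp: flat_def\<close>)
    then show ?thesis using x by (simp add: flat_def)
  next
    assume x: "x > 0"
    have "((\<lambda>x. poly q (1 / x) * exp (- (1 / x))) has_real_derivative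
        poly ((q - pderiv q) * [:0, 0, 1:]) (1 / x) * exp (- (1 / x))) (at x)"
      using x by (auto intro!: derivative_eq_intros DERIV_chain2[OF poly_DERIV]
          simp: power2_eq_square field_simps)
    then have "(flat q has_real_derivative 
        poly ((q - pderiv q) * [:0, 0, 1:]) (1 / x) * exp (- (1 / x))) (at x)"
      by (rule has_field_derivative_transform_within_open[where S="{0<..}"]) (use x in \<open>auto simp: flat_def\<close>)
    then show ?thesis using x by (simp add: flat_def)
  next
    assume x: "x = 0"
    have "((\<lambda>y. poly (q * [:0, 1:]) (1 / y) * exp (- (1 / y))) \<longlongrightarrow> 0) (at_right 0)"
      by (rule filterlim_compose[OF poly_times_exp_minus_tendsto_0])
        (simp add: filterlim_inverse_at_top_right divide_inverse)
    then have "((\<lambda>y. flat q y / y) \<longlongrightarrow> 0) (at_right 0)"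
      by (rule Lim_transform_eventually)
        (auto simp: flat_def eventually_at_filter field_simps)
    moreover have "((\<lambda>y. flat q y / y) \<longlongrightarrow> 0) (at_left 0)"
      by (rule Lim_transform_eventually[of "\<lambda>_. 0"]) (auto simp: flat_def eventually_at_filter)
    ultimately have "((\<lambda>y. flat q y / y) \<longlongrightarrow> 0) (at 0)"
      using filterlim_split_at by blast
    then show ?thesis using x by (simp add: DERIV_def flat_def)
  qed
qed

lemma differentiable_times_flat: "differentiable_times n (flat q)"
  by (induction n arbitrary: q) (auto intro: flat_has_derivative)

text \<open>A smooth transition from 0 on the negative half-line to 1 beyond 1. The denominator is positive
  since \<open>x\<close> and \<open>1 - x\<close> are never both nonpositive.\<close>

definition smooth_step :: "real \<Rightarrow> real" where
  "smooth_step x = flat 1 x * inverse (flat 1 x + flat 1 (1 - x))"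

lemma smooth_step_denominator_pos: "flat 1 x + flat 1 (1 - x) > 0"
  by (auto simp: flat_def add_pos_pos)

lemma differentiable_times_smooth_step: "differentiable_times n smooth_step"
proof -
  have "differentiable_times n (\<lambda>x. flat 1 x * inverse (flat 1 x + flat 1 ((-1) * x + 1)))"
    using smooth_step_denominator_pos
    by (intro differentiable_times_mult differentiable_times_inverse differentiable_times_add
        differentiable_times_flat differentiable_times_compose_affine)
      (simp add: less_imp_neq[symmetric] add.commute)
  then show ?thesis by (simp add: smooth_step_def[abs_def] add.commute)
qed

lemma smooth_step_le_0 [simp]: "x \<le> 0 \<Longrightarrow> smooth_step x = 0"
  by (simp add: smooth_step_def flat_def)

lemma smooth_step_ge_1 [simp]: "x \<ge> 1 \<Longrightarrow> smooth_step x = 1"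
  by (simp add: smooth_step_def flat_def)

lemma smooth_step_bounds: "0 \<le> smooth_step x" "smooth_step x \<le> 1"
proof -
  have "flat 1 x \<ge> 0" "flat 1 (1 - x) \<ge> 0" by (auto simp: flat_def)
  with smooth_step_denominator_pos[of x] show "0 \<le> smooth_step x" "smooth_step x \<le> 1"
    by (auto simp: smooth_step_def field_simps)
qed

lemma smooth_step_has_derivative: "(smooth_step has_real_derivative deriv smooth_step x) (at x)"
  using differentiable_times_smooth_step[of "Suc 0"]
  by (auto simp: DERIV_deriv_iff_field_differentiable field_differentiable_def)

lemma continuous_deriv_smooth_step: "continuous_on UNIV (deriv smooth_step)"
proof -
  obtain d d' where d: "\<And>x. (smooth_step has_real_derivative d x) (at x)"
    "\<And>x. (d has_real_derivative d' x) (at x)"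
    using differentiable_times_smooth_step[of "Suc (Suc 0)"] by auto
  then have "deriv smooth_step = d"
    by (auto simp: fun_eq_iff intro!: DERIV_imp_deriv)
  with d(2) show ?thesis
    by (auto intro!: continuous_at_imp_continuous_on intro: DERIV_isCont)
qed

lemma deriv_smooth_step_nonneg: "deriv smooth_step x \<ge> 0"
proof -
  have mono: "mono_on UNIV smooth_step"
  proof (rule mono_onI)
    fix x y :: real assume "x \<le> y"
    have fmono: "flat 1 a \<le> flat 1 b" if "a \<le> b" for a b
      using that by (auto simp: flat_def field_simps)
    (* a / (a + b) \<le> a' / (a' + b') amounts to a b' \<le> a' b for positive denominators *)
    have "flat 1 x * flat 1 (1 - y) \<le> flat 1 y * flat 1 (1 - x)"
      using \<open>x \<le> y\<close> by (intro mult_mono fmono) (auto simp: flat_def)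
    then show "smooth_step x \<le> smooth_step y"
      using smooth_step_denominator_pos[of x] smooth_step_denominator_pos[of y]
      by (simp add: smooth_step_def field_simps)
  qed
  show ?thesis
    by (rule mono_on_imp_deriv_nonneg[OF mono smooth_step_has_derivative]) simp
qed

lemma deriv_smooth_step_eq_0:
  assumes "x < 0 \<or> x > 1"
  shows "deriv smooth_step x = 0"
proof -
  define S :: "real set" where "S = (if x < 0 then {..<0} else {1<..})"
  have "((\<lambda>_. smooth_step x) has_real_derivative 0) (at x)" by simp
  then have "(smooth_step has_real_derivative 0) (at x)"
    by (rule has_field_derivative_transform_within_open[where S=S])
      (use assms in \<open>auto simp: S_def split: if_splits\<close>)
  then show ?thesis by (rule DERIV_imp_deriv)
qed

lemma exp_has_vector_derivative:
  "((\<lambda>x. exp (a * of_real x)) has_vector_derivative a * exp (a * of_real x)) (at x)" for a :: complex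
  by (rule has_vector_derivative_eq_rhs[OF has_vector_derivative_real_field])
    (auto intro!: derivative_eq_intros)

lemma Re_exp_has_derivative:
  fixes a z :: complex
  shows "((\<lambda>x. Re (z * exp (a * of_real x))) has_real_derivative Re (z * a * exp (a * of_real x))) (at x)"
proof -
  have "((\<lambda>x. z * exp (a * of_real x)) has_vector_derivative z * (a * exp (a * of_real x))) (at x)"
    by (rule has_vector_derivative_mult_right[OF exp_has_vector_derivative])
  then show ?thesis
    unfolding has_real_derivative_iff_has_vector_derivative mult.assoc
    by (rule bounded_linear.has_vector_derivative[OF bounded_linear_Re])
qed

lemma differentiable_times_exp:
  fixes a z :: complex
  shows "differentiable_times n (\<lambda>x. Re (z * exp (a * of_real x)))"
proof (induction n arbitrary: z)
  case (Suc n)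
  show ?case by (rule differentiable_times_SucI[OF Re_exp_has_derivative Suc.IH])
qed simp

section \<open>Weak derivatives and increments\<close>

lemma integrable_M0pi_continuous:
  fixes f :: "real \<Rightarrow> 'a :: euclidean_space"
  assumes "continuous_on {0..pi} f"
  shows "integrable M0pi f"
proof -
  have "f absolutely_integrable_on {0..pi}"
    using absolutely_integrable_continuous[of 0 pi f] assms by simp
  then have "f absolutely_integrable_on {0<..<pi}"
    by (rule set_integrable_subset) auto
  then show ?thesis
    by (simp add: set_integrable_def integrable_restrict_space)
qed

lemma integral_M0pi_FTC:
  fixes G :: "real \<Rightarrow> 'a :: euclidean_space"
  assumes "continuous_on {0..pi} g"
    and "\<And>x. x \<in> {0..pi} \<Longrightarrow> (G has_vector_derivative g x) (at x within {0..pi})"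
  shows "(LINT x|M0pi. g x) = G pi - G 0"
proof -
  have "(g has_integral (LINT x|M0pi. g x)) {0<..<pi}"
    using integrable_M0pi_continuous[OF assms(1)] by (intro has_integral_integral_lebesgue_on) auto
  then have "(g has_integral (LINT x|M0pi. g x)) {0..pi}"
    by (simp add: has_integral_Icc_iff_Ioo)
  moreover have "(g has_integral G pi - G 0) {0..pi}"
    using assms by (intro fundamental_theorem_of_calculus) auto
  ultimately show ?thesis by (rule has_integral_unique)
qed

lemma integrable_M0pi_continuous_mult:
  fixes p :: "real \<Rightarrow> 'b :: euclidean_space" and f :: "real \<Rightarrow> 'a :: euclidean_space"
    and h :: "'b \<Rightarrow> 'a \<Rightarrow> 'c :: euclidean_space"
  assumes "bounded_bilinear h" "continuous_on {0..pi} p" "integrable M0pi f"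
  shows "integrable M0pi (\<lambda>x. h (p x) (f x))"
proof -
  interpret bounded_bilinear h by fact
  obtain K where K: "\<And>a b. norm (h a b) \<le> norm a * norm b * K"
    using bounded by blast
  have "compact (p ` {0..pi})" using assms(2) by (intro compact_continuous_image) auto
  then obtain B where B: "B > 0" "\<And>x. x \<in> {0..pi} \<Longrightarrow> norm (p x) \<le> B"
    using compact_imp_bounded bounded_pos by (metis image_eqI)
  have pm: "p \<in> borel_measurable M0pi" and fm: "f \<in> borel_measurable M0pi"
    using integrable_M0pi_continuous[OF assms(2)] assms(3) by auto
  have m: "(\<lambda>x. h (p x) (f x)) \<in> borel_measurable M0pi"
    by (rule borel_measurable_continuous_Pair[OF pm fm])
       (intro continuous_intros continuous_on)
  show ?thesis
  proof (rule Bochner_Integration.integrable_bound[OF _ m])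
    show "integrable M0pi (\<lambda>x. B * norm (f x) * \<bar>K\<bar>)" using assms(3) by simp
    show "AE x in M0pi. norm (h (p x) (f x)) \<le> norm (B * norm (f x) * \<bar>K\<bar>)"
    proof (rule AE_I2)
      fix x assume x: "x \<in> space M0pi"
      have "norm (h (p x) (f x)) \<le> norm (p x) * norm (f x) * K" by (rule K)
      also have "\<dots> \<le> norm (p x) * norm (f x) * \<bar>K\<bar>" by (intro mult_left_mono) auto
      also have "\<dots> \<le> B * norm (f x) * \<bar>K\<bar>"
        using B x by (intro mult_right_mono) auto
      also have "\<dots> \<le> norm (B * norm (f x) * \<bar>K\<bar>)" by simp
      finally show "norm (h (p x) (f x)) \<le> norm (B * norm (f x) * \<bar>K\<bar>)" .
    qed
  qed
qed

lemmas integrable_M0pi_scaleR = integrable_M0pi_continuous_mult[OF bounded_bilinear_scaleR]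
lemmas integrable_M0pi_mult = integrable_M0pi_continuous_mult[OF bounded_bilinear_mult]

lemma test_functionI:
  assumes "\<And>n. differentiable_times n \<phi>" "compact K" "K \<subseteq> {0<..<pi}" "\<And>x. x \<notin> K \<Longrightarrow> \<phi> x = 0"
  shows "test_function \<phi>"
  using assms differentiable_times_imp_deriv unfolding test_function_def by blast

lemma test_function_has_derivative:
  "test_function \<phi> \<Longrightarrow> (\<phi> has_real_derivative deriv \<phi> x) (at x)"
  unfolding test_function_def using DERIV_deriv_iff_field_differentiable funpow_0 by metis

lemma test_function_continuous:
  assumes "test_function \<phi>"
  shows "continuous_on S \<phi>" "continuous_on S (deriv \<phi>)"
proof -
  have "continuous_on S ((deriv ^^ n) \<phi>)" for n
    using assms unfolding test_function_def
    by (simp add: continuous_at_imp_continuous_on field_differentiable_imp_continuous_at)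
  from this[of 0] this[of 1] show "continuous_on S \<phi>" "continuous_on S (deriv \<phi>)"
    by simp_all
qed

text \<open>Weak derivatives of honest functions with values in any Euclidean space, so that the components of
  an \<open>L\<^sup>2\<close> function and their products with exponentials can be treated alike.\<close>

definition weak_derivative :: "(real \<Rightarrow> 'a :: euclidean_space) \<Rightarrow> (real \<Rightarrow> 'a) \<Rightarrow> bool" where
  "weak_derivative f g \<longleftrightarrow> integrable M0pi f \<and> integrable M0pi g \<and>
     (\<forall>\<phi>. test_function \<phi> \<longrightarrow> (LINT x|M0pi. deriv \<phi> x *\<^sub>R f x) = - (LINT x|M0pi. \<phi> x *\<^sub>R g x))"

lemma smooth_step_affine_has_derivative:
  "((\<lambda>x. smooth_step (m * (x - c) - d)) has_real_derivative m * deriv smooth_step (m * (x - c) - d)) (at x)"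
proof -
  have "((\<lambda>x. m * (x - c) - d) has_real_derivative m) (at x)"
    by (auto intro!: derivative_eq_intros)
  from DERIV_chain2[OF smooth_step_has_derivative this] show ?thesis
    by (simp add: mult.commute)
qed

lemma continuous_smooth_step_kernel:
  "continuous_on S (\<lambda>x. m * deriv smooth_step (m * (x - c) - d))"
  by (intro continuous_intros continuous_on_compose2[OF continuous_deriv_smooth_step]) auto

text \<open>The rescaled derivative of the step is an approximate identity at \<open>c\<close>: it is nonnegative,
  concentrates on a window of length \<open>1/n\<close> that starts at \<open>c + d/n\<close>, and has total mass 1 because
  the window stays inside \<open>[0, \<pi>]\<close>. The offset \<open>d\<close> lets \<open>c\<close> be an endpoint of the interval.\<close>

lemma smooth_step_kernel_tendsto:
  fixes F :: "real \<Rightarrow> 'a :: euclidean_space"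
  assumes F: "continuous_on {0..pi} F" and c: "c \<in> {0..pi}"
    and window: "eventually (\<lambda>n. 0 \<le> c + d / real n \<and> c + (d + 1) / real n \<le> pi) sequentially"
  shows "(\<lambda>n. LINT x|M0pi. (real n * deriv smooth_step (real n * (x - c) - d)) *\<^sub>R F x) \<longlonglongrightarrow> F c"
proof (rule metric_LIMSEQ_I)
  fix e :: real assume e: "e > 0"
  obtain \<delta> where \<delta>: "\<delta> > 0" "\<And>x. x \<in> {0..pi} \<Longrightarrow> dist x c < \<delta> \<Longrightarrow> dist (F x) (F c) < e / 2"
    using F c e unfolding continuous_on_iff by (metis half_gt_zero)
  have "(\<lambda>n. (\<bar>d\<bar> + 1) * inverse (real n)) \<longlonglongrightarrow> (\<bar>d\<bar> + 1) * 0"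
    by (intro tendsto_intros lim_inverse_n)
  then have "eventually (\<lambda>n. (\<bar>d\<bar> + 1) * inverse (real n) < \<delta>) sequentially"
    using \<delta>(1) by (intro order_tendstoD(2)) auto
  with window eventually_gt_at_top[of 0]
  have "eventually (\<lambda>n. dist (LINT x|M0pi. (real n * deriv smooth_step (real n * (x - c) - d)) *\<^sub>R F x) (F c) < e) sequentially"
  proof eventually_elim
    case (elim n)
    define K where "K = (\<lambda>x. real n * deriv smooth_step (real n * (x - c) - d))"
    have K: "continuous_on S K" for S unfolding K_def by (rule continuous_smooth_step_kernel)
    have K0: "K x \<ge> 0" for x using deriv_smooth_step_nonneg by (simp add: K_def)
    have n: "real n > 0" using elim by simp
    have "real n * (pi - c) - d \<ge> 1" "real n * (0 - c) - d \<le> 0"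
      using elim n by (auto simp: field_simps)
    then have int1: "(LINT x|M0pi. K x) = 1"
      using integral_M0pi_FTC[OF K, of "\<lambda>x. smooth_step (real n * (x - c) - d)"]
        smooth_step_affine_has_derivative[of "real n" c d]
      by (simp add: K_def has_real_derivative_iff_has_vector_derivative has_vector_derivative_at_within)
    have intK: "integrable M0pi K" by (rule integrable_M0pi_continuous[OF K])
    have near: "K x * norm (F x - F c) \<le> K x * (e / 2)" if "x \<in> {0..pi}" for x
    proof (cases "dist x c < \<delta>")
      case True
      with \<delta>(2)[OF that] show ?thesis by (intro mult_left_mono K0) (simp add: dist_norm)
    next
      case False
      have "real n * (x - c) - d < 0 \<or> real n * (x - c) - d > 1"
      proof (rule ccontr)
        assume "\<not> ?thesis"
        then have "\<bar>real n * (x - c)\<bar> \<le> \<bar>d\<bar> + 1" by linarith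
        then have "real n * \<bar>x - c\<bar> \<le> \<bar>d\<bar> + 1" using n by (simp add: abs_mult)
        then have "\<bar>x - c\<bar> \<le> (\<bar>d\<bar> + 1) * inverse (real n)" using n by (simp add: field_simps)
        with False elim show False by (simp add: dist_real_def)
      qed
      then show ?thesis by (simp add: K_def deriv_smooth_step_eq_0)
    qed
    have int: "integrable M0pi (\<lambda>x. K x *\<^sub>R F x)" "integrable M0pi (\<lambda>x. K x *\<^sub>R F c)"
      "integrable M0pi (\<lambda>x. K x *\<^sub>R (F x - F c))"
      by (intro integrable_M0pi_continuous continuous_intros K F)+
    have "(LINT x|M0pi. K x *\<^sub>R F x) - F c = (LINT x|M0pi. K x *\<^sub>R F x) - (LINT x|M0pi. K x *\<^sub>R F c)"
      using int1 intK by simp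
    also have "\<dots> = (LINT x|M0pi. K x *\<^sub>R (F x - F c))"
      using int by (simp add: scaleR_diff_right)
    finally have "dist (LINT x|M0pi. K x *\<^sub>R F x) (F c) \<le> (LINT x|M0pi. norm (K x *\<^sub>R (F x - F c)))"
      by (simp only: dist_norm integral_norm_bound)
    also have "\<dots> \<le> (LINT x|M0pi. K x * (e / 2))"
      using integrable_norm[OF int(3)] intK near K0 by (intro integral_mono) auto
    also have "\<dots> = e / 2" using int1 by simp
    also have "\<dots> < e" using e by simp
    finally show ?case by (simp add: K_def)
  qed
  then show "\<exists>no. \<forall>n\<ge>no. dist (LINT x|M0pi. (real n * deriv smooth_step (real n * (x - c) - d)) *\<^sub>R F x) (F c) < e"
    by (simp add: eventually_sequentially)
qed

text \<open>Test against smooth cut-offs that converge to the indicator of \<open>(a, b)\<close>. Their derivatives are the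
  difference of two approximate identities, at \<open>a\<close> and at \<open>b\<close>, so the left-hand side of the weak
  identity tends to \<open>F a - F b\<close>; the right-hand side converges by dominated convergence.\<close>

lemma weak_derivative_increment:
  fixes f g F :: "real \<Rightarrow> 'a :: euclidean_space"
  assumes w: "weak_derivative f g" and F: "continuous_on {0..pi} F"
    and fF: "AE x in M0pi. f x = F x" and ab: "0 \<le> a" "a < b" "b \<le> pi"
  shows "F b - F a = (LINT x|M0pi. indicator {a<..<b} x *\<^sub>R g x)"
proof -
  (* The offsets 1 and -2 push the rising and the falling edge inside (a, b) by at least 1/n,
     so that the support is compact in (0, pi) even for a = 0 or b = pi. *)
  define cut where "cut = (\<lambda>(n::nat) x. smooth_step (real n * (x - a) - 1) - smooth_step (real n * (x - b) - (-2)))"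
  define Ka where "Ka = (\<lambda>(n::nat) x. real n * deriv smooth_step (real n * (x - a) - 1))"
  define Kb where "Kb = (\<lambda>(n::nat) x. real n * deriv smooth_step (real n * (x - b) - (-2)))"
  have large: "eventually (\<lambda>n. real n * (y - x) \<ge> C) sequentially" if "x < y" for x y C :: real
  proof -
    have "eventually (\<lambda>n. real n \<ge> C / (y - x)) sequentially"
      using filterlim_real_sequentially by (simp add: filterlim_at_top)
    then show ?thesis
      by eventually_elim (use that in \<open>simp add: field_simps\<close>)
  qed
  have lim_a: "(\<lambda>n. LINT x|M0pi. Ka n x *\<^sub>R F x) \<longlonglongrightarrow> F a"
    unfolding Ka_def
  proof (rule smooth_step_kernel_tendsto[OF F])
    show "eventually (\<lambda>n. 0 \<le> a + 1 / real n \<and> a + (1 + 1) / real n \<le> pi) sequentially"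
      using large[OF ab(2), of 2] eventually_gt_at_top[of 0]
    proof eventually_elim
      case (elim n)
      then have "2 / real n \<le> b - a" by (simp add: field_simps)
      then show ?case using ab by simp
    qed
  qed (use ab in auto)
  have lim_b: "(\<lambda>n. LINT x|M0pi. Kb n x *\<^sub>R F x) \<longlonglongrightarrow> F b"
    unfolding Kb_def
  proof (rule smooth_step_kernel_tendsto[OF F])
    show "eventually (\<lambda>n. 0 \<le> b + (-2) / real n \<and> b + (-2 + 1) / real n \<le> pi) sequentially"
      using large[OF ab(2), of 2] eventually_gt_at_top[of 0]
    proof eventually_elim
      case (elim n)
      then have "2 / real n \<le> b - a" by (simp add: field_simps)
      moreover have "(-2 + 1) / real n \<le> 0" "(-2) / real n = - (2 / real n)" by simp_all
      ultimately show ?case using ab by linarith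
    qed
  qed (use ab in auto)
  have lim_g: "(\<lambda>n. LINT x|M0pi. cut n x *\<^sub>R g x) \<longlonglongrightarrow> (LINT x|M0pi. indicator {a<..<b} x *\<^sub>R g x)"
  proof (rule integral_dominated_convergence[where w="\<lambda>x. norm (g x)"])
    have gm: "g \<in> borel_measurable M0pi" and gi: "integrable M0pi g"
      using w by (auto simp: weak_derivative_def)
    then show "integrable M0pi (\<lambda>x. norm (g x))" by simp
    have step: "continuous_on S (\<lambda>x. smooth_step (real n * (x - c) - d))" for n c d S
      using smooth_step_affine_has_derivative[of "real n" c d]
      by (intro continuous_at_imp_continuous_on ballI) (rule DERIV_isCont)
    then have chi: "continuous_on S (cut n)" for n S
      unfolding cut_def by (intro continuous_on_diff step)
    show "(\<lambda>x. cut n x *\<^sub>R g x) \<in> borel_measurable M0pi" for n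
      by (rule borel_measurable_integrable[OF integrable_M0pi_scaleR[OF chi gi]])
    have "(\<lambda>x. indicator {a<..<b} x :: real) \<in> borel_measurable M0pi"
      by (intro measurable_restrict_space1 measurable_completion) simp
    then show "(\<lambda>x. indicator {a<..<b} x *\<^sub>R g x) \<in> borel_measurable M0pi"
      using gm by (rule borel_measurable_scaleR)
    show "AE x in M0pi. norm (cut n x *\<^sub>R g x) \<le> norm (g x)" for n
    proof (rule AE_I2)
      fix x
      have "\<bar>cut n x\<bar> \<le> 1"
        using smooth_step_bounds[of "real n * (x - a) - 1"] smooth_step_bounds[of "real n * (x - b) - (-2)"]
        by (simp add: cut_def)
      then show "norm (cut n x *\<^sub>R g x) \<le> norm (g x)"
        by (simp add: mult_left_le_one_le)
    qed
    show "AE x in M0pi. (\<lambda>n. cut n x *\<^sub>R g x) \<longlonglongrightarrow> indicator {a<..<b} x *\<^sub>R g x"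
    proof (rule AE_I2, rule tendsto_eventually)
      fix x
      consider "x \<le> a" | "a < x" "x < b" | "b \<le> x" by linarith
      then show "eventually (\<lambda>n. cut n x *\<^sub>R g x = indicator {a<..<b} x *\<^sub>R g x) sequentially"
      proof cases
        assume x: "x \<le> a"
        then have "x < b" using ab by simp
        from large[OF this, of 2] show ?thesis
        proof eventually_elim
          case (elim n)
          have "real n * (x - a) \<le> 0" using x by (simp add: mult_nonneg_nonpos)
          with elim x show ?case by (simp add: cut_def right_diff_distrib)
        qed
      next
        assume x: "a < x" "x < b"
        from large[OF x(1), of 2] large[OF x(2), of 2] show ?thesis
          by eventually_elim (use x in \<open>simp add: cut_def right_diff_distrib\<close>)
      next
        assume x: "b \<le> x"
        then have "a < x" using ab by simp
        from large[OF this, of 2] show ?thesis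
        proof eventually_elim
          case (elim n)
          have "real n * (x - b) \<ge> 0" using x by simp
          with elim x show ?case by (simp add: cut_def right_diff_distrib)
        qed
      qed
    qed
  qed
  have "eventually (\<lambda>n. (LINT x|M0pi. Ka n x *\<^sub>R F x) - (LINT x|M0pi. Kb n x *\<^sub>R F x)
      = - (LINT x|M0pi. cut n x *\<^sub>R g x)) sequentially"
    using large[OF ab(2), of 4] eventually_gt_at_top[of 0]
  proof eventually_elim
    case (elim n)
    have n: "real n > 0" using elim by simp
    have "4 / real n \<le> b - a" using elim by (simp add: field_simps)
    moreover have "4 / real n = 2 / real n + 2 / real n" by simp
    ultimately have gap: "a + 2 / real n \<le> b - 2 / real n" by linarith
    have pos: "1 / real n > 0" using n by simp
    have "test_function (cut n)"
    proof (rule test_functionI)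
      have "differentiable_times k (\<lambda>x. smooth_step (real n * x + (- real n * a - 1))
          + (-1) * smooth_step (real n * x + (- real n * b + 2)))" for k
        by (intro differentiable_times_add differentiable_times_mult differentiable_times_const
            differentiable_times_compose_affine[OF differentiable_times_smooth_step])
      moreover have "(\<lambda>x. smooth_step (real n * x + (- real n * a - 1))
          + (-1) * smooth_step (real n * x + (- real n * b + 2))) = cut n"
      proof
        fix x
        have "real n * x + (- real n * a - 1) = real n * (x - a) - 1"
          "real n * x + (- real n * b + 2) = real n * (x - b) - (-2)"
          by (simp_all add: right_diff_distrib)
        then show "smooth_step (real n * x + (- real n * a - 1))
          + (-1) * smooth_step (real n * x + (- real n * b + 2)) = cut n x"
          unfolding cut_def by (simp only: mult_minus1 diff_conv_add_uminus)
      qed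
      ultimately show "differentiable_times k (cut n)" for k by simp
      show "compact {a + 1 / real n..b - 1 / real n}" by simp
      show "{a + 1 / real n..b - 1 / real n} \<subseteq> {0<..<pi}"
      proof
        fix x assume "x \<in> {a + 1 / real n..b - 1 / real n}"
        then have "a + 1 / real n \<le> x" "x \<le> b - 1 / real n" by auto
        with ab pos have "0 < x" "x < pi" by linarith+
        then show "x \<in> {0<..<pi}" by simp
      qed
      show "cut n x = 0" if "x \<notin> {a + 1 / real n..b - 1 / real n}" for x
      proof -
        define t where "t = 1 / real n"
        have t: "t > 0" "real n * t = 1" "a + 2 * t \<le> b - 2 * t"
          using n gap by (simp_all add: t_def)
        from that consider "x < a + t" | "x > b - t" unfolding t_def by fastforce
        then show ?thesis
        proof cases
          assume "x < a + t"
          then have "x - a \<le> t" "x - b \<le> - 2 * t" using t by linarith+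
          then have "real n * (x - a) \<le> real n * t" "real n * (x - b) \<le> real n * (- 2 * t)"
            using n by (intro mult_left_mono; simp)+
          then show ?thesis using t by (simp add: cut_def)
        next
          assume "x > b - t"
          then have "2 * t \<le> x - a" "- t \<le> x - b" using t by linarith+
          then have "real n * (2 * t) \<le> real n * (x - a)" "real n * (- t) \<le> real n * (x - b)"
            using n by (intro mult_left_mono; simp)+
          then show ?thesis using t by (simp add: cut_def)
        qed
      qed
    qed
    then have "(LINT x|M0pi. deriv (cut n) x *\<^sub>R f x) = - (LINT x|M0pi. cut n x *\<^sub>R g x)"
      using w by (simp add: weak_derivative_def)
    also have "deriv (cut n) = (\<lambda>x. Ka n x - Kb n x)"
      unfolding cut_def Ka_def Kb_def
      by (rule ext, rule DERIV_imp_deriv, rule DERIV_diff) (rule smooth_step_affine_has_derivative)+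
    also have "(LINT x|M0pi. (Ka n x - Kb n x) *\<^sub>R f x) = (LINT x|M0pi. (Ka n x - Kb n x) *\<^sub>R F x)"
    proof (rule integral_cong_AE)
      have c: "continuous_on {0..pi} (\<lambda>x. Ka n x - Kb n x)"
        unfolding Ka_def Kb_def by (intro continuous_intros continuous_smooth_step_kernel)
      show "(\<lambda>x. (Ka n x - Kb n x) *\<^sub>R f x) \<in> borel_measurable M0pi"
        using integrable_M0pi_scaleR[OF c, of f] w by (auto simp: weak_derivative_def)
      show "(\<lambda>x. (Ka n x - Kb n x) *\<^sub>R F x) \<in> borel_measurable M0pi"
        using integrable_M0pi_scaleR[OF c integrable_M0pi_continuous[OF F]] by auto
    qed (use fF in auto)
    also have "\<dots> = (LINT x|M0pi. Ka n x *\<^sub>R F x) - (LINT x|M0pi. Kb n x *\<^sub>R F x)"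
    proof -
      have "integrable M0pi (\<lambda>x. Ka n x *\<^sub>R F x)" "integrable M0pi (\<lambda>x. Kb n x *\<^sub>R F x)"
        unfolding Ka_def Kb_def
        by (intro integrable_M0pi_continuous continuous_intros F continuous_smooth_step_kernel)+
      then show ?thesis by (simp add: scaleR_diff_left)
    qed
    finally show ?case .
  qed
  moreover have "(\<lambda>n. (LINT x|M0pi. Ka n x *\<^sub>R F x) - (LINT x|M0pi. Kb n x *\<^sub>R F x)) \<longlonglongrightarrow> F a - F b"
    by (intro tendsto_diff lim_a lim_b)
  ultimately have "(\<lambda>n. - (LINT x|M0pi. cut n x *\<^sub>R g x)) \<longlonglongrightarrow> F a - F b"
    by (rule Lim_transform_eventually[rotated])
  moreover have "(\<lambda>n. - (LINT x|M0pi. cut n x *\<^sub>R g x)) \<longlonglongrightarrow> - (LINT x|M0pi. indicator {a<..<b} x *\<^sub>R g x)"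
    by (intro tendsto_minus lim_g)
  ultimately have "F a - F b = - (LINT x|M0pi. indicator {a<..<b} x *\<^sub>R g x)"
    by (rule LIMSEQ_unique)
  then show ?thesis by (metis minus_diff_eq minus_minus)
qed

section \<open>Integrating factors for weak derivatives\<close>

lemma test_function_differentiable_times:
  assumes "test_function \<phi>"
  shows "differentiable_times n \<phi>"
proof -
  have "differentiable_times n ((deriv ^^ m) \<phi>)" for m
  proof (induction n arbitrary: m)
    case (Suc n)
    have "((deriv ^^ m) \<phi> has_real_derivative (deriv ^^ Suc m) \<phi> x) (at x)" for x
      using assms by (simp add: test_function_def DERIV_deriv_iff_field_differentiable)
    then show ?case by (rule differentiable_times_SucI[OF _ Suc.IH])
  qed simp
  from this[of 0] show ?thesis by simp
qed

lemma test_function_mult: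
  assumes "test_function \<phi>" "\<And>n. differentiable_times n \<psi>"
  shows "test_function (\<lambda>x. \<phi> x * \<psi> x)"
proof -
  obtain K where "compact K" "K \<subseteq> {0<..<pi}" "\<And>x. x \<notin> K \<Longrightarrow> \<phi> x = 0"
    using assms(1) by (auto simp: test_function_def)
  then show ?thesis
    using differentiable_times_mult[OF test_function_differentiable_times[OF assms(1)] assms(2)]
    by (intro test_functionI[of _ K]) auto
qed

text \<open>Product rule for the weak derivative. Test functions are real-valued while the exponential is
  complex, so the weak identity is used with the test functions \<open>\<phi> Re (z e)\<close>; since
  \<open>Re w + \<i> Re (- \<i> w) = w\<close>, the choices \<open>z = 1\<close> and \<open>z = - \<i>\<close> recover the complex statement.\<close>

lemma weak_derivative_exp_mult:
  fixes f g :: "real \<Rightarrow> complex" and a :: complex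
  assumes w: "weak_derivative f g"
  shows "weak_derivative (\<lambda>x. exp (a * of_real x) * f x) (\<lambda>x. exp (a * of_real x) * (g x + a * f x))"
  unfolding weak_derivative_def
proof (intro conjI allI impI)
  have fi: "integrable M0pi f" and gi: "integrable M0pi g"
    and w: "\<And>\<phi>. test_function \<phi> \<Longrightarrow> (LINT x|M0pi. deriv \<phi> x *\<^sub>R f x) = - (LINT x|M0pi. \<phi> x *\<^sub>R g x)"
    using w by (auto simp: weak_derivative_def)
  define e where "e = (\<lambda>x::real. exp (a * of_real x))"
  have e: "continuous_on S e" for S unfolding e_def by (intro continuous_intros)
  show "integrable M0pi (\<lambda>x. exp (a * of_real x) * f x)"
    using integrable_M0pi_mult[OF e fi] by (simp add: e_def)
  show "integrable M0pi (\<lambda>x. exp (a * of_real x) * (g x + a * f x))"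
    using integrable_M0pi_mult[OF e, of "\<lambda>x. g x + a * f x"] fi gi by (simp add: e_def)
  fix \<phi> assume \<phi>: "test_function \<phi>"
  note c = test_function_continuous[OF \<phi>]
  define I where "I p h z = (LINT x|M0pi. (p x * Re (z * e x)) *\<^sub>R h x)"
    for p :: "real \<Rightarrow> real" and h :: "real \<Rightarrow> complex" and z
  have part: "I (deriv \<phi>) f z = - I \<phi> g z - I \<phi> f (z * a)" for z
  proof -
    have d: "deriv (\<lambda>x. \<phi> x * Re (z * e x)) = (\<lambda>x. deriv \<phi> x * Re (z * e x) + \<phi> x * Re (z * a * e x))"
      using DERIV_mult[OF test_function_has_derivative[OF \<phi>] Re_exp_has_derivative[of z a]]
      by (intro ext DERIV_imp_deriv) (simp add: e_def ac_simps)
    have "test_function (\<lambda>x. \<phi> x * Re (z * e x))"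
      unfolding e_def by (rule test_function_mult[OF \<phi> differentiable_times_exp])
    from w[OF this] have "(LINT x|M0pi. (deriv \<phi> x * Re (z * e x) + \<phi> x * Re (z * a * e x)) *\<^sub>R f x)
        = - I \<phi> g z"
      unfolding I_def d .
    moreover have "integrable M0pi (\<lambda>x. (deriv \<phi> x * Re (z * e x)) *\<^sub>R f x)"
      "integrable M0pi (\<lambda>x. (\<phi> x * Re (z * a * e x)) *\<^sub>R f x)"
      by (intro integrable_M0pi_scaleR fi continuous_intros c e)+
    ultimately have "I (deriv \<phi>) f z + I \<phi> f (z * a) = - I \<phi> g z"
      unfolding I_def scaleR_add_left by (simp only: Bochner_Integration.integral_add)
    then show ?thesis by (simp add: eq_diff_eq)
  qed
  have split: "I p h z + \<i> * I p h (- \<i> * z) = (LINT x|M0pi. p x *\<^sub>R (z * e x * h x))"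
    if p: "continuous_on {0..pi} p" and h: "integrable M0pi h" for p h z
  proof -
    have i: "integrable M0pi (\<lambda>x. (p x * Re (z * e x)) *\<^sub>R h x)"
      "integrable M0pi (\<lambda>x. \<i> * ((p x * Re (- \<i> * z * e x)) *\<^sub>R h x))"
      by (intro integrable_M0pi_scaleR integrable_mult_right impI h continuous_intros p e)+
    have "I p h z + \<i> * I p h (- \<i> * z)
      = (LINT x|M0pi. (p x * Re (z * e x)) *\<^sub>R h x + \<i> * ((p x * Re (- \<i> * z * e x)) *\<^sub>R h x))"
      unfolding I_def Bochner_Integration.integral_add[OF i] by (simp only: integral_mult_right_zero)
    also have "\<dots> = (LINT x|M0pi. p x *\<^sub>R (z * e x * h x))"
      by (rule Bochner_Integration.integral_cong[OF refl]) (simp add: complex_eq_iff algebra_simps)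
    finally show ?thesis .
  qed
  have "(LINT x|M0pi. deriv \<phi> x *\<^sub>R (1 * e x * f x)) =
      - (LINT x|M0pi. \<phi> x *\<^sub>R (1 * e x * g x)) - (LINT x|M0pi. \<phi> x *\<^sub>R (a * e x * f x))"
    unfolding split[OF c(2) fi, symmetric] split[OF c(1) gi, symmetric] split[OF c(1) fi, symmetric]
      part by (simp add: algebra_simps)
  then have "(LINT x|M0pi. deriv \<phi> x *\<^sub>R (e x * f x)) =
      - (LINT x|M0pi. \<phi> x *\<^sub>R (e x * g x)) - (LINT x|M0pi. \<phi> x *\<^sub>R (a * e x * f x))"
    by simp
  also have "\<dots> = - ((LINT x|M0pi. \<phi> x *\<^sub>R (e x * g x)) + (LINT x|M0pi. \<phi> x *\<^sub>R (a * e x * f x)))"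
    by simp
  also have "\<dots> = - (LINT x|M0pi. \<phi> x *\<^sub>R (e x * g x) + \<phi> x *\<^sub>R (a * e x * f x))"
  proof -
    have "integrable M0pi (\<lambda>x. \<phi> x *\<^sub>R (e x * g x))" "integrable M0pi (\<lambda>x. \<phi> x *\<^sub>R (a * e x * f x))"
      by (intro integrable_M0pi_scaleR integrable_M0pi_mult fi gi continuous_intros c e)+
    then show ?thesis by (simp only: Bochner_Integration.integral_add)
  qed
  also have "\<dots> = - (LINT x|M0pi. \<phi> x *\<^sub>R (e x * (g x + a * f x)))"
    by (simp only: distrib_left scaleR_add_right mult.assoc mult.left_commute[of a])
  finally show "(LINT x|M0pi. deriv \<phi> x *\<^sub>R (exp (a * of_real x) * f x)) =
      - (LINT x|M0pi. \<phi> x *\<^sub>R (exp (a * of_real x) * (g x + a * f x)))"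
    by (simp add: e_def)
qed


lemma l2_cases:
  obtains f0 where "f = abs_l2 f0" "square_integrable f0"
proof -
  have "l2_eq (rep_l2 f) (rep_l2 f)" "abs_l2 (rep_l2 f) = f"
    by (rule Quotient_rep_reflp[OF Quotient_l2], rule Quotient_abs_rep[OF Quotient_l2])
  then show ?thesis using that[of "rep_l2 f"] by (simp add: l2_eq_def)
qed

lemma l2_eq_refl: "square_integrable f \<Longrightarrow> l2_eq f f"
  by (simp add: l2_eq_def)

lemma abs_l2_eq_iff:
  assumes "square_integrable f" "square_integrable g"
  shows "abs_l2 f = abs_l2 g \<longleftrightarrow> (AE x in M0pi. f x = g x)"
proof -
  have "l2_eq f g \<longleftrightarrow> l2_eq f f \<and> l2_eq g g \<and> abs_l2 f = abs_l2 g"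
    by (rule Quotient_rel[OF Quotient_l2, symmetric])
  then show ?thesis using assms by (simp add: l2_eq_def)
qed

lemma square_integrable_imp_integrable:
  assumes "square_integrable f"
  shows "integrable M0pi f"
proof (rule Bochner_Integration.integrable_bound)
  show "integrable M0pi (\<lambda>x. 1 + (norm (f x))\<^sup>2)"
    using assms integrable_M0pi_continuous[of "\<lambda>x. 1::real"] by (simp add: square_integrable_def)
  show "f \<in> borel_measurable M0pi" using assms by (simp add: square_integrable_def)
  have "norm v \<le> 1 + (norm v)\<^sup>2" for v :: "complex ^ 2"
  proof -
    have "2 * norm v \<le> (norm v)\<^sup>2 + 1"
      using zero_le_power2[of "norm v - 1"] by (simp add: power2_diff)
    with norm_ge_zero[of v] show ?thesis by linarith
  qed
  then show "AE x in M0pi. norm (f x) \<le> norm (1 + (norm (f x))\<^sup>2)" by simp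
qed

lemma has_weak_derivative_component:
  assumes sq: "square_integrable f" "square_integrable g"
    and w: "has_weak_derivative (abs_l2 f) (abs_l2 g)"
  shows "weak_derivative (\<lambda>x. f x $ i) (\<lambda>x. g x $ i)"
  unfolding weak_derivative_def
proof (intro conjI allI impI)
  have fi: "integrable M0pi f" and gi: "integrable M0pi g"
    using sq by (auto intro: square_integrable_imp_integrable)
  note nth = integrable_bounded_linear[OF bounded_linear_vec_nth]
  show "integrable M0pi (\<lambda>x. f x $ i)" "integrable M0pi (\<lambda>x. g x $ i)"
    by (rule nth fi gi)+
  fix \<phi> assume \<phi>: "test_function \<phi>"
  have "(LINT x|M0pi. deriv \<phi> x *\<^sub>R f x) = - (LINT x|M0pi. \<phi> x *\<^sub>R g x)"
    using w \<phi> has_weak_derivative.abs_eq[OF l2_eq_refl l2_eq_refl] sq by blast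
  then have "(LINT x|M0pi. deriv \<phi> x *\<^sub>R f x) $ i = - ((LINT x|M0pi. \<phi> x *\<^sub>R g x) $ i)"
    by simp
  then show "(LINT x|M0pi. deriv \<phi> x *\<^sub>R f x $ i) = - (LINT x|M0pi. \<phi> x *\<^sub>R g x $ i)"
    using integral_bounded_linear[OF bounded_linear_vec_nth integrable_M0pi_scaleR[OF test_function_continuous(2)[OF \<phi>] fi], of i]
      integral_bounded_linear[OF bounded_linear_vec_nth integrable_M0pi_scaleR[OF test_function_continuous(1)[OF \<phi>] gi], of i]
    by simp
qed

text \<open>With the integrating factor \<open>exp (a x)\<close> a first-order operator becomes a pure derivative. This one
  formula therefore both solves the eigenvalue equation and shows which functional kills the range.\<close>

lemma weak_exp_increment:
  fixes a :: complex
  assumes sq: "square_integrable f" "square_integrable g"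
    and w: "has_weak_derivative (abs_l2 f) (abs_l2 g)"
    and F: "continuous_representative (abs_l2 f) F" and b: "0 < b" "b \<le> pi"
  shows "exp (a * of_real b) * F b $ i - F 0 $ i =
    (LINT x|M0pi. indicator {0<..<b} x *\<^sub>R (exp (a * of_real x) * (g x $ i + a * f x $ i)))"
proof -
  have F: "continuous_on {0..pi} F" "AE x in M0pi. f x = F x"
    using F continuous_representative.abs_eq[OF l2_eq_refl[OF sq(1)]] by auto
  have "exp (a * of_real b) * F b $ i - exp (a * of_real 0) * F 0 $ i =
    (LINT x|M0pi. indicator {0<..<b} x *\<^sub>R (exp (a * of_real x) * (g x $ i + a * f x $ i)))"
  proof (rule weak_derivative_increment[OF weak_derivative_exp_mult[OF has_weak_derivative_component[OF sq w]]])
    show "continuous_on {0..pi} (\<lambda>x. exp (a * of_real x) * F x $ i)"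
      using F by (intro continuous_intros)
    show "AE x in M0pi. exp (a * of_real x) * f x $ i = exp (a * of_real x) * F x $ i"
      using F(2) by eventually_elim simp
  qed (use b in auto)
  then show ?thesis by simp
qed

section \<open>Explicit elements, eigenvectors and ranges\<close>

definition pair_l2 :: "(real \<Rightarrow> complex) \<Rightarrow> (real \<Rightarrow> complex) \<Rightarrow> l2" where
  "pair_l2 p q = abs_l2 (\<lambda>x. vector [p x, q x])"

lemma continuous_on_vector_2:
  assumes "continuous_on S p" "continuous_on S q"
  shows "continuous_on S (\<lambda>x. vector [p x, q x] :: complex ^ 2)"
proof -
  have eq: "vector [p x, q x] = ((\<chi> i. if i = 1 then p x else q x) :: complex ^ 2)" for x
    by (simp add: vec_eq_iff forall_2)
  have "continuous_on S (\<lambda>x. (\<chi> i. if i = 1 then p x else q x) :: complex ^ 2)"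
  proof (rule continuous_on_vec_lambda)
    show "continuous_on S (\<lambda>x. if i = 1 then p x else q x)" for i :: 2
      using assms by (cases "i = 1") auto
  qed
  then show ?thesis unfolding eq .
qed

lemma norm_vector_2: "(norm (vector [a, b] :: complex ^ 2))\<^sup>2 = (cmod a)\<^sup>2 + (cmod b)\<^sup>2"
  by (simp add: norm_vec_def L2_set_def sum_2)

lemma inner_vector_2: "(v :: complex ^ 2) \<bullet> vector [a, b] = Re (v $ 1 * cnj a + v $ 2 * cnj b)"
  by (simp add: inner_vec_def sum_2 inner_complex_def)

lemma square_integrable_pair:
  assumes "continuous_on {0..pi} p" "continuous_on {0..pi} q"
  shows "square_integrable (\<lambda>x. vector [p x, q x])"
  unfolding square_integrable_def
proof
  have "continuous_on {0..pi} (\<lambda>x. (norm (vector [p x, q x] :: complex ^ 2))\<^sup>2)"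
    by (intro continuous_intros continuous_on_vector_2 assms)
  then show "integrable M0pi (\<lambda>x. (norm (vector [p x, q x] :: complex ^ 2))\<^sup>2)"
    by (rule integrable_M0pi_continuous)
  show "(\<lambda>x. vector [p x, q x] :: complex ^ 2) \<in> borel_measurable M0pi"
    by (rule borel_measurable_integrable[OF integrable_M0pi_continuous[OF continuous_on_vector_2[OF assms]]])
qed

lemma inner_abs_l2:
  "square_integrable f \<Longrightarrow> square_integrable g \<Longrightarrow> abs_l2 f \<bullet> abs_l2 g = (LINT x|M0pi. f x \<bullet> g x)"
  by (simp add: inner_l2.abs_eq l2_eq_def)

lemma inner_pair_l2:
  assumes "square_integrable f" "continuous_on {0..pi} p" "continuous_on {0..pi} q"
  shows "abs_l2 f \<bullet> pair_l2 p q = (LINT x|M0pi. Re (f x $ 1 * cnj (p x) + f x $ 2 * cnj (q x)))"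
  unfolding pair_l2_def
  by (subst inner_abs_l2) (simp_all only: assms square_integrable_pair inner_vector_2)

lemma norm_pair_l2:
  assumes "continuous_on {0..pi} p" "continuous_on {0..pi} q"
  shows "(norm (pair_l2 p q))\<^sup>2 = (LINT x|M0pi. (cmod (p x))\<^sup>2 + (cmod (q x))\<^sup>2)"
proof -
  have "(norm (pair_l2 p q))\<^sup>2 = pair_l2 p q \<bullet> pair_l2 p q"
    by (simp add: power2_norm_eq_inner)
  also have "\<dots> = (LINT x|M0pi. (norm (vector [p x, q x] :: complex ^ 2))\<^sup>2)"
    unfolding pair_l2_def
    by (subst inner_abs_l2) (simp_all add: assms square_integrable_pair power2_norm_eq_inner)
  finally show ?thesis by (simp add: norm_vector_2)
qed

text \<open>The estimates below have exponential room to spare, so bounds through the supremum suffice.\<close>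

lemma norm_pair_l2_le:
  assumes "continuous_on {0..pi} p" "continuous_on {0..pi} q"
    and "\<And>x. 0 < x \<Longrightarrow> x < pi \<Longrightarrow> cmod (p x) \<le> B" "\<And>x. 0 < x \<Longrightarrow> x < pi \<Longrightarrow> cmod (q x) \<le> B"
    and "B \<ge> 0"
  shows "norm (pair_l2 p q) \<le> sqrt (2 * pi) * B"
proof -
  have "(norm (pair_l2 p q))\<^sup>2 \<le> (LINT x|M0pi. 2 * B\<^sup>2)"
    unfolding norm_pair_l2[OF assms(1,2)]
  proof (rule integral_mono)
    show "integrable M0pi (\<lambda>x. (cmod (p x))\<^sup>2 + (cmod (q x))\<^sup>2)"
      by (intro integrable_M0pi_continuous continuous_intros assms)
    show "integrable M0pi (\<lambda>x. 2 * B\<^sup>2)"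
      by (intro integrable_M0pi_continuous continuous_intros)
    fix x assume "x \<in> space M0pi"
    then have "(cmod (p x))\<^sup>2 \<le> B\<^sup>2" "(cmod (q x))\<^sup>2 \<le> B\<^sup>2"
      using assms(3-5) by (auto intro!: power_mono)
    then show "(cmod (p x))\<^sup>2 + (cmod (q x))\<^sup>2 \<le> 2 * B\<^sup>2" by simp
  qed
  also have "\<dots> = (sqrt (2 * pi) * B)\<^sup>2"
  proof -
    have "((\<lambda>x. x * (2 * B\<^sup>2)) has_vector_derivative 2 * B\<^sup>2) (at x within S)" for x S
      unfolding has_real_derivative_iff_has_vector_derivative[symmetric]
      by (auto intro!: derivative_eq_intros)
    then have "(LINT x|M0pi. 2 * B\<^sup>2) = pi * (2 * B\<^sup>2) - 0 * (2 * B\<^sup>2)"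
      by (intro integral_M0pi_FTC continuous_intros)
    then show ?thesis by (simp only: power_mult_distrib) simp
  qed
  finally show ?thesis
    by (rule power2_le_imp_le) (use assms in simp)
qed

lemma continuous_representative_pair:
  assumes "continuous_on {0..pi} p" "continuous_on {0..pi} q"
  shows "continuous_representative (pair_l2 p q) (\<lambda>x. vector [p x, q x])"
  unfolding pair_l2_def
  by (subst continuous_representative.abs_eq) (simp_all add: l2_eq_def square_integrable_pair continuous_on_vector_2 assms)

text \<open>Integration by parts; the boundary terms vanish with the test function.\<close>

lemma has_weak_derivative_pair:
  assumes p: "\<And>x. (p has_vector_derivative p' x) (at x)" and q: "\<And>x. (q has_vector_derivative q' x) (at x)"
    and p': "continuous_on {0..pi} p'" and q': "continuous_on {0..pi} q'"
  shows "has_weak_derivative (pair_l2 p q) (pair_l2 p' q')"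
proof -
  have cp: "continuous_on {0..pi} p" and cq: "continuous_on {0..pi} q"
    using p q by (auto intro!: continuous_at_imp_continuous_on has_vector_derivative_continuous)
  let ?f = "\<lambda>x. vector [p x, q x] :: complex ^ 2" and ?g = "\<lambda>x. vector [p' x, q' x] :: complex ^ 2"
  note c = continuous_on_vector_2[OF cp cq] continuous_on_vector_2[OF p' q']
  have axis: "vector [a, b] = axis 1 a + (axis 2 b :: complex ^ 2)" for a b :: complex
    by (simp add: vec_eq_iff forall_2 axis_def)
  have bl: "bounded_linear (axis i :: complex \<Rightarrow> complex ^ 2)" for i
    by (rule linear_conv_bounded_linear[THEN iffD1], rule linearI)
      (simp_all add: vec_eq_iff axis_def)
  have der: "(?f has_vector_derivative ?g x) (at x)" for x
    unfolding axis by (intro has_vector_derivative_add bounded_linear.has_vector_derivative[OF bl] p q)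
  have "(LINT x|M0pi. deriv \<phi> x *\<^sub>R ?f x) = - (LINT x|M0pi. \<phi> x *\<^sub>R ?g x)"
    if \<phi>: "test_function \<phi>" for \<phi>
  proof -
    obtain K where K: "K \<subseteq> {0<..<pi}" "\<And>x. x \<notin> K \<Longrightarrow> \<phi> x = 0"
      using \<phi> by (auto simp: test_function_def)
    have ends: "\<phi> 0 = 0" "\<phi> pi = 0" using K by force+
    note c\<phi> = test_function_continuous[OF \<phi>]
    have i: "integrable M0pi (\<lambda>x. \<phi> x *\<^sub>R ?g x)" "integrable M0pi (\<lambda>x. deriv \<phi> x *\<^sub>R ?f x)"
      by (intro integrable_M0pi_continuous continuous_on_scaleR c\<phi> c)+
    have "(LINT x|M0pi. \<phi> x *\<^sub>R ?g x + deriv \<phi> x *\<^sub>R ?f x) = \<phi> pi *\<^sub>R ?f pi - \<phi> 0 *\<^sub>R ?f 0"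
    proof (rule integral_M0pi_FTC)
      show "continuous_on {0..pi} (\<lambda>x. \<phi> x *\<^sub>R ?g x + deriv \<phi> x *\<^sub>R ?f x)"
        by (intro continuous_on_add continuous_on_scaleR c\<phi> c)
      show "((\<lambda>x. \<phi> x *\<^sub>R ?f x) has_vector_derivative \<phi> x *\<^sub>R ?g x + deriv \<phi> x *\<^sub>R ?f x) (at x within {0..pi})" for x
        using has_vector_derivative_scaleR[OF DERIV_subset[OF test_function_has_derivative[OF \<phi>]]
            has_vector_derivative_at_within[OF der]] by simp
    qed
    then show ?thesis
      unfolding Bochner_Integration.integral_add[OF i] ends by (simp add: eq_neg_iff_add_eq_0 add.commute)
  qed
  then show ?thesis
    unfolding pair_l2_def
    by (subst has_weak_derivative.abs_eq) (simp_all add: l2_eq_def square_integrable_pair cp cq p' q')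
qed

lemma cscale_pair:
  assumes "continuous_on {0..pi} p" "continuous_on {0..pi} q"
  shows "cscale c (pair_l2 p q) = pair_l2 (\<lambda>x. c * p x) (\<lambda>x. c * q x)"
proof -
  have "(\<lambda>x. c *s (vector [p x, q x] :: complex ^ 2)) = (\<lambda>x. vector [c * p x, c * q x])"
    by (rule ext) (simp add: vec_eq_iff forall_2)
  then show ?thesis
    unfolding pair_l2_def
    by (subst cscale.abs_eq) (simp_all add: l2_eq_def square_integrable_pair assms)
qed

lemma diag_mult_pair:
  assumes "continuous_on {0..pi} p" "continuous_on {0..pi} q"
  shows "diag_mult a b (pair_l2 p q) = pair_l2 (\<lambda>x. a * p x) (\<lambda>x. b * q x)"
  unfolding pair_l2_def
  by (subst diag_mult.abs_eq) (simp_all add: l2_eq_def square_integrable_pair assms)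

lemma add_pair:
  assumes "continuous_on {0..pi} p" "continuous_on {0..pi} q" "continuous_on {0..pi} p'" "continuous_on {0..pi} q'"
  shows "pair_l2 p q + pair_l2 p' q' = pair_l2 (\<lambda>x. p x + p' x) (\<lambda>x. q x + q' x)"
proof -
  have "(\<lambda>x. vector [p x, q x] + vector [p' x, q' x] :: complex ^ 2) = (\<lambda>x. vector [p x + p' x, q x + q' x])"
    by (rule ext) (simp add: vec_eq_iff forall_2)
  then show ?thesis
    unfolding pair_l2_def
    by (subst plus_l2.abs_eq) (simp_all add: l2_eq_def square_integrable_pair assms)
qed

lemma norm_cscale: "norm (cscale c f) = cmod c * norm f"
proof -
  obtain f0 where f: "f = abs_l2 f0" "square_integrable f0" by (rule l2_cases)
  have sq: "square_integrable (\<lambda>x. c *s f0 x)"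
    by (rule square_integrable_linear[OF bounded_linear_vector_scalar_mult f(2)])
  have nv: "norm (c *s v) = cmod c * norm v" for v :: "complex ^ 2"
    by (simp add: norm_vec_def norm_mult L2_set_right_distrib)
  have "(norm (cscale c f))\<^sup>2 = cscale c f \<bullet> cscale c f" by (simp add: power2_norm_eq_inner)
  also have "\<dots> = (LINT x|M0pi. (norm (c *s f0 x))\<^sup>2)"
    unfolding f(1) by (simp add: cscale.abs_eq l2_eq_refl f inner_abs_l2 sq power2_norm_eq_inner)
  also have "\<dots> = (cmod c)\<^sup>2 * (LINT x|M0pi. (norm (f0 x))\<^sup>2)"
    by (simp add: nv power_mult_distrib)
  also have "\<dots> = (cmod c * norm f)\<^sup>2"
    unfolding f(1) power_mult_distrib by (simp add: power2_norm_eq_inner inner_abs_l2 f)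
  finally show ?thesis by (simp add: power2_eq_iff_nonneg)
qed

text \<open>Eigenspaces are at most one-dimensional: by the integrating factor each component is determined by
  its value at 0, and the boundary condition at 0 makes these two values agree.\<close>

lemma L_op_eigenvector:
  assumes u: "u \<noteq> 0" and v: "(v, cscale \<mu> v) \<in> L_op u"
  obtains c where "v = cscale c (pair_l2 (\<lambda>x. exp (\<mu> / u * of_real x)) (\<lambda>x. exp (\<mu> / cnj u * of_real x)))"
proof -
  from v obtain v' where v': "v \<in> L_domain" "has_weak_derivative v v'" "diag_mult u (cnj u) v' = cscale \<mu> v"
    by (auto simp: L_op_def)
  from v'(1) obtain F where F: "continuous_representative v F" "F 0 $ 1 = F 0 $ 2"
    by (auto simp: L_domain_def)
  obtain f where f: "v = abs_l2 f" "square_integrable f" by (rule l2_cases)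
  obtain g where g: "v' = abs_l2 g" "square_integrable g" by (rule l2_cases)
  have sq: "square_integrable (\<lambda>x. vector [u * g x $ 1, cnj u * g x $ 2])"
    "square_integrable (\<lambda>x. \<mu> *s f x)"
    by (rule square_integrable_linear[OF bounded_linear_diag g(2)]
        square_integrable_linear[OF bounded_linear_vector_scalar_mult f(2)])+
  have "AE x in M0pi. vector [u * g x $ 1, cnj u * g x $ 2] = \<mu> *s f x"
    using v'(3) unfolding f(1) g(1) abs_l2_eq_iff[OF sq, symmetric]
    by (simp add: diag_mult.abs_eq cscale.abs_eq l2_eq_refl f g)
  then have ae: "AE x in M0pi. u * g x $ 1 = \<mu> * f x $ 1 \<and> cnj u * g x $ 2 = \<mu> * f x $ 2"
    by eventually_elim (simp add: vec_eq_iff forall_2)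
  have comp: "F b $ i = F 0 $ i * exp (\<mu> / w * of_real b)"
    if w: "w \<noteq> 0" and wi: "AE x in M0pi. w * g x $ i = \<mu> * f x $ i" and b: "0 < b" "b \<le> pi" for w i b
  proof -
    have "exp (- \<mu> / w * of_real b) * F b $ i - F 0 $ i =
      (LINT x|M0pi. indicator {0<..<b} x *\<^sub>R (exp (- \<mu> / w * of_real x) * (g x $ i + - \<mu> / w * f x $ i)))"
      using weak_exp_increment[OF f(2) g(2) _ _ b] v'(2) F(1) f g by blast
    also have "\<dots> = 0"
    proof (rule integral_eq_zero_AE)
      show "AE x in M0pi. indicator {0<..<b} x *\<^sub>R (exp (- \<mu> / w * of_real x) * (g x $ i + - \<mu> / w * f x $ i)) = 0"
        using wi by eventually_elim (use w in \<open>auto simp: field_simps\<close>)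
    qed
    finally have "exp (- (\<mu> / w * of_real b)) * F b $ i = F 0 $ i" by simp
    then show ?thesis by (simp add: exp_minus field_simps)
  qed
  have F1: "F b $ 1 = F 0 $ 1 * exp (\<mu> / u * of_real b)"
    and F2: "F b $ 2 = F 0 $ 1 * exp (\<mu> / cnj u * of_real b)" if "0 < b" "b \<le> pi" for b
    using comp[OF u _ that, of 1] comp[of "cnj u" 2, OF _ _ that] ae F(2) u by (auto elim: AE_mp)
  let ?e = "\<lambda>x. vector [exp (\<mu> / u * of_real x), exp (\<mu> / cnj u * of_real x)] :: complex ^ 2"
  have ce: "continuous_on {0..pi} (\<lambda>x. exp (\<mu> / w * of_real x))" for w
    by (intro continuous_intros)
  have sqe: "square_integrable ?e" by (intro square_integrable_pair ce)
  have "AE x in M0pi. f x = F x"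
    using F(1) continuous_representative.abs_eq[OF l2_eq_refl[OF f(2)]] f(1) by simp
  then have "AE x in M0pi. f x = F 0 $ 1 *s ?e x"
    using AE_space
  proof eventually_elim
    case (elim x)
    then show ?case using F1[of x] F2[of x] by (simp add: vec_eq_iff forall_2)
  qed
  then have "v = abs_l2 (\<lambda>x. F 0 $ 1 *s ?e x)"
    unfolding f(1)
    by (subst abs_l2_eq_iff[OF f(2) square_integrable_linear[OF bounded_linear_vector_scalar_mult sqe]])
  also have "\<dots> = cscale (F 0 $ 1) (pair_l2 (\<lambda>x. exp (\<mu> / u * of_real x)) (\<lambda>x. exp (\<mu> / cnj u * of_real x)))"
    by (simp only: pair_l2_def cscale.abs_eq[OF l2_eq_refl[OF sqe]])
  finally show ?thesis by (rule that)
qed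

text \<open>For an eigenvalue \<open>\<mu>\<close> this is the eigenvector of the adjoint of \<open>L\<^sub>u\<close> for the
  conjugate of \<open>\<mu>\<close>, up to scaling. The inner product of \<^typ>\<open>l2\<close> is the real part of the complex
  pairing, and the factor \<open>\<omega>\<close> rotates the value of the latter before its real part is taken.\<close>

definition annihilator :: "complex \<Rightarrow> complex \<Rightarrow> complex \<Rightarrow> l2" where
  "annihilator u \<mu> \<omega> = pair_l2 (\<lambda>x. \<omega> * cnj (exp (- \<mu> / u * of_real x) / u))
     (\<lambda>x. - \<omega> * cnj (exp (- \<mu> / cnj u * of_real x) / cnj u))"

text \<open>The pairing of \<open>(L\<^sub>u - \<mu>) f\<close> with the annihilator reduces to boundary terms in both components.
  The boundary conditions, together with the assumption that the two exponentials agree at \<open>\<pi>\<close>,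
  make them cancel.\<close>

lemma annihilator_range:
  assumes u: "u \<noteq> 0" and f: "(f, h + cscale \<mu> f) \<in> L_op u"
    and per: "exp (- \<mu> / u * of_real pi) = exp (- \<mu> / cnj u * of_real pi)"
  shows "h \<bullet> annihilator u \<mu> \<omega> = 0"
proof -
  from f obtain f' where f': "f \<in> L_domain" "has_weak_derivative f f'" "diag_mult u (cnj u) f' = h + cscale \<mu> f"
    by (auto simp: L_op_def)
  from f'(1) obtain F where F: "continuous_representative f F" "F 0 $ 1 = F 0 $ 2" "F pi $ 1 = F pi $ 2"
    by (auto simp: L_domain_def)
  obtain f0 where f0: "f = abs_l2 f0" "square_integrable f0" by (rule l2_cases)
  obtain g where g: "f' = abs_l2 g" "square_integrable g" by (rule l2_cases)
  have sq: "square_integrable (\<lambda>x. vector [u * g x $ 1, cnj u * g x $ 2])"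
    "square_integrable (\<lambda>x. (- \<mu>) *s f0 x)"
    by (rule square_integrable_linear[OF bounded_linear_diag g(2)]
        square_integrable_linear[OF bounded_linear_vector_scalar_mult f0(2)])+
  have "cscale \<mu> f + cscale (- \<mu>) f = 0"
  proof -
    have zero: "(\<lambda>x. \<mu> *s f0 x + (- \<mu>) *s f0 x) = (\<lambda>_. 0)"
      by (rule ext) (simp add: vec_eq_iff)
    have "square_integrable (\<lambda>x. \<mu> *s f0 x)"
      by (rule square_integrable_linear[OF bounded_linear_vector_scalar_mult f0(2)])
    from plus_l2.abs_eq[OF l2_eq_refl[OF this] l2_eq_refl[OF sq(2)]] show ?thesis
      unfolding f0(1) zero_l2_def cscale.abs_eq[OF l2_eq_refl[OF f0(2)]] by (simp only: zero)
  qed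
  then have h: "h = diag_mult u (cnj u) f' + cscale (- \<mu>) f"
    using f'(3) by (simp add: add.assoc)
  let ?h = "\<lambda>x. vector [u * g x $ 1, cnj u * g x $ 2] + (- \<mu>) *s f0 x"
  have h0: "h = abs_l2 ?h"
    unfolding h f0(1) g(1)
    by (simp only: diag_mult.abs_eq[OF l2_eq_refl[OF g(2)]] cscale.abs_eq[OF l2_eq_refl[OF f0(2)]]
        plus_l2.abs_eq[OF l2_eq_refl[OF sq(1)] l2_eq_refl[OF sq(2)]])
  have sqh: "square_integrable ?h" by (rule square_integrable_add[OF sq])
  define P where "P w i x = exp (- \<mu> / w * of_real x) * (g x $ i + - \<mu> / w * f0 x $ i)" for w x and i :: 2
  have intP: "integrable M0pi (P w i)" for w i
  proof -
    note nth = integrable_bounded_linear[OF bounded_linear_vec_nth square_integrable_imp_integrable]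
    have "integrable M0pi (\<lambda>x. g x $ i + - \<mu> / w * f0 x $ i)"
      using nth[OF f0(2), of i] nth[OF g(2), of i] by simp
    then show ?thesis
      unfolding P_def by (intro integrable_M0pi_mult continuous_intros)
  qed
  have P: "(LINT x|M0pi. P w i x) = exp (- \<mu> / w * of_real pi) * F pi $ i - F 0 $ i" for w i
  proof -
    have "exp (- \<mu> / w * of_real pi) * F pi $ i - F 0 $ i = (LINT x|M0pi. indicator {0<..<pi} x *\<^sub>R P w i x)"
      unfolding P_def
      using weak_exp_increment[OF f0(2) g(2) _ _ pi_gt_zero order.refl] f'(2) F(1) f0 g by blast
    also have "\<dots> = (LINT x|M0pi. P w i x)"
      by (rule Bochner_Integration.integral_cong[OF refl]) simp
    finally show ?thesis by simp
  qed
  have c: "continuous_on {0..pi} (\<lambda>x. a * cnj (exp (- \<mu> / w * of_real x) / w))" for w a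
    by (cases "w = 0") (auto intro!: continuous_intros)
  have "h \<bullet> annihilator u \<mu> \<omega> = (LINT x|M0pi. Re (?h x $ 1 * cnj (\<omega> * cnj (exp (- \<mu> / u * of_real x) / u))
       + ?h x $ 2 * cnj (- \<omega> * cnj (exp (- \<mu> / cnj u * of_real x) / cnj u))))"
    unfolding h0 annihilator_def by (rule inner_pair_l2[OF sqh c c])
  also have "\<dots> = (LINT x|M0pi. Re (cnj \<omega> * (P u 1 x - P (cnj u) 2 x)))"
  proof (rule Bochner_Integration.integral_cong[OF refl])
    fix x
    have split: "(w * b - \<mu> * a) * (z * (E / w)) = z * (E * (b + - \<mu> / w * a))" if "w \<noteq> 0" for a b w z E
      using that by (simp add: field_simps)
    show "Re (?h x $ 1 * cnj (\<omega> * cnj (exp (- \<mu> / u * of_real x) / u))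
       + ?h x $ 2 * cnj (- \<omega> * cnj (exp (- \<mu> / cnj u * of_real x) / cnj u))) = Re (cnj \<omega> * (P u 1 x - P (cnj u) 2 x))"
      using split[OF u, of "g x $ 1" "f0 x $ 1" "cnj \<omega>" "exp (- \<mu> / u * of_real x)"]
        split[of "cnj u" "g x $ 2" "f0 x $ 2" "cnj \<omega>" "exp (- \<mu> / cnj u * of_real x)"] u
      unfolding P_def by (simp del: times_complex.sel add: right_diff_distrib)
  qed
  also have "\<dots> = Re (cnj \<omega> * (LINT x|M0pi. P u 1 x - P (cnj u) 2 x))"
    by (simp del: times_complex.sel add: intP)
  also have "(LINT x|M0pi. P u 1 x - P (cnj u) 2 x) = 0"
    by (simp add: intP P F) (simp add: per[simplified])
  finally show ?thesis by simp
qed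

section \<open>Growth of eigenfunctions under similarity\<close>

text \<open>The eigenfunction of \<open>L\<^sub>u\<close> for \<open>\<mu>\<close>, provided that its components agree at \<open>\<pi>\<close>.\<close>

definition exp_pair :: "complex \<Rightarrow> complex \<Rightarrow> l2" where
  "exp_pair u \<mu> = pair_l2 (\<lambda>x. exp (\<mu> / u * of_real x)) (\<lambda>x. exp (\<mu> / cnj u * of_real x))"

lemma L_op_pairI:
  assumes "\<And>x. (p has_vector_derivative p' x) (at x)" "\<And>x. (q has_vector_derivative q' x) (at x)"
    and "continuous_on {0..pi} p'" "continuous_on {0..pi} q'"
    and "p 0 = q 0" "p pi = q pi"
  shows "(pair_l2 p q, pair_l2 (\<lambda>x. u * p' x) (\<lambda>x. cnj u * q' x)) \<in> L_op u"
proof -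
  have c: "continuous_on {0..pi} p" "continuous_on {0..pi} q"
    using assms(1,2) by (auto intro!: continuous_at_imp_continuous_on has_vector_derivative_continuous)
  have w: "has_weak_derivative (pair_l2 p q) (pair_l2 p' q')"
    by (rule has_weak_derivative_pair[OF assms(1-4)])
  moreover have "pair_l2 p q \<in> L_domain"
    using w continuous_representative_pair[OF c] assms(5,6)
    by (auto simp: L_domain_def W12_def intro!: exI[of _ "\<lambda>x. vector [p x, q x]"])
  ultimately show ?thesis
    unfolding L_op_def using diag_mult_pair[OF assms(3,4), of u "cnj u"] by force
qed

lemma continuous_exp: "continuous_on S (\<lambda>x::real. exp (a * of_real x :: complex))"
  by (intro continuous_intros)

text \<open>The circle \<open>s\<^sup>2 + t\<^sup>2 = k t\<close> becomes the line \<open>1/u = (r - \<i>)/k\<close> under inversion. The slope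
  \<open>r = s/t\<close> is the coordinate that distinguishes the operators: the eigenvalues \<open>k n\<close> do not depend on it, and the
  eigenfunctions have modulus \<open>exp (n r x)\<close> in both components.\<close>

locale eigen_parameter =
  fixes k r :: real and u :: complex
  assumes k: "k > 0" and r: "r \<ge> 0" and u_nz: "u \<noteq> 0" and inv_u: "1 / u = Complex r (- 1) / k"
begin

lemma inv_cnj_u: "1 / cnj u = Complex r 1 / k"
proof -
  have "1 / cnj u = cnj (1 / u)" by simp
  also have "\<dots> = Complex r 1 / k" unfolding inv_u by (simp add: complex_eq_iff)
  finally show ?thesis .
qed

lemma inv_cnj_u_diff: "1 / cnj u = 1 / u + 2 * \<i> / k"
  unfolding inv_u inv_cnj_u using k by (simp add: complex_eq_iff)

abbreviation ev :: "nat \<Rightarrow> complex" where "ev n \<equiv> of_real (k * real n)"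

lemma ev_div: "ev n / u = of_nat n * Complex r (- 1)" "ev n / cnj u = of_nat n * Complex r 1"
proof -
  have "ev n / u = ev n * (1 / u)" "ev n / cnj u = ev n * (1 / cnj u)" by simp_all
  then show "ev n / u = of_nat n * Complex r (- 1)" "ev n / cnj u = of_nat n * Complex r 1"
    unfolding inv_u inv_cnj_u using k by (simp_all add: complex_eq_iff)
qed

lemma cmod_exp_ev:
  "cmod (exp (ev n / u * of_real x)) = exp (real n * r * x)"
  "cmod (exp (ev n / cnj u * of_real x)) = exp (real n * r * x)"
  unfolding ev_div by simp_all

lemma exp_ev_pi: "exp (ev n / u * of_real pi) = exp (ev n / cnj u * of_real pi)"
proof -
  have "exp (ev n / cnj u * of_real pi) = exp (ev n / u * of_real pi + (2 * of_nat n * of_real pi) * \<i>)"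
    unfolding ev_div by (rule arg_cong[of _ _ exp]) (simp add: complex_eq_iff)
  also have "\<dots> = exp (ev n / u * of_real pi)"
    unfolding exp_add using exp_integer_2pi[OF Ints_of_nat, of n] by (simp add: mult.assoc)
  finally show ?thesis by simp
qed

lemma exp_pair_eigen: "(exp_pair u (ev n), cscale (ev n) (exp_pair u (ev n))) \<in> L_op u"
proof -
  have "(exp_pair u (ev n), pair_l2 (\<lambda>x. u * (ev n / u * exp (ev n / u * of_real x)))
      (\<lambda>x. cnj u * (ev n / cnj u * exp (ev n / cnj u * of_real x)))) \<in> L_op u"
    unfolding exp_pair_def
    by (rule L_op_pairI[OF exp_has_vector_derivative exp_has_vector_derivative])
      (intro continuous_on_mult continuous_on_const continuous_exp
        | simp only: exp_ev_pi of_real_0 mult_zero_right)+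
  moreover have "(\<lambda>x. w * (ev n / w * exp (ev n / w * of_real x))) = (\<lambda>x. ev n * exp (ev n / w * of_real x))"
    if "w \<noteq> 0" for w using that by simp
  ultimately show ?thesis
    unfolding exp_pair_def cscale_pair[OF continuous_exp continuous_exp]
    using u_nz by (metis complex_cnj_zero_iff)
qed

lemma norm_exp_pair_le: "norm (exp_pair u (ev n)) \<le> sqrt (2 * pi) * exp (real n * r * pi)"
  unfolding exp_pair_def
  by (rule norm_pair_l2_le[OF continuous_exp continuous_exp])
    (auto simp only: cmod_exp_ev exp_le_cancel_iff intro!: mult_left_mono mult_nonneg_nonneg r, auto)

lemma norm_exp_pair:
  assumes "r > 0" "n > 0"
  shows "(norm (exp_pair u (ev n)))\<^sup>2 = (exp (2 * real n * r * pi) - 1) / (real n * r)"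
proof -
  have "(norm (exp_pair u (ev n)))\<^sup>2 = (LINT x|M0pi. 2 * exp (2 * real n * r * x))"
    unfolding exp_pair_def norm_pair_l2[OF continuous_exp continuous_exp] cmod_exp_ev
    by (simp add: power2_eq_square exp_add[symmetric] mult_ac)
  also have "\<dots> = exp (2 * real n * r * pi) / (real n * r) - exp (2 * real n * r * 0) / (real n * r)"
  proof (rule integral_M0pi_FTC)
    show "((\<lambda>x. exp (2 * real n * r * x) / (real n * r)) has_vector_derivative 2 * exp (2 * real n * r * x))
        (at x within {0..pi})" for x
      unfolding has_real_derivative_iff_has_vector_derivative[symmetric]
      using assms by (auto intro!: derivative_eq_intros)
  qed (intro continuous_intros)
  finally show ?thesis by (simp add: diff_divide_distrib)
qed

lemma norm_annihilator_le:
  assumes "cmod \<omega> \<le> 1"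
  shows "norm (annihilator u (ev n) \<omega>) \<le> sqrt (2 * pi) * (1 / cmod u)"
proof -
  have c: "continuous_on {0..pi} (\<lambda>x. a * cnj (exp (- b * of_real x) / w))" for a b w :: complex
    by (cases "w = 0") (auto intro!: continuous_intros)
  have "cmod (a * cnj (exp (- (ev n / w) * of_real x) / w)) \<le> 1 / cmod u"
    if "0 < x" "cmod a \<le> 1" "w = u \<or> w = cnj u" for x a w
  proof -
    have "exp (- (ev n / w) * of_real x) = inverse (exp (ev n / w * of_real x))"
      by (simp add: exp_minus)
    then have "cmod (exp (- (ev n / w) * of_real x)) = inverse (exp (real n * r * x))"
      using that(3) cmod_exp_ev by (auto simp: norm_inverse)
    also have "\<dots> \<le> 1" using that r by (simp add: inverse_le_1_iff)
    finally have "cmod a * cmod (exp (- (ev n / w) * of_real x)) \<le> 1"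
      using that(2) by (simp add: mult_le_one)
    then have "cmod a * cmod (exp (- (ev n / w) * of_real x)) / cmod u \<le> 1 / cmod u"
      by (intro divide_right_mono) auto
    moreover have "cmod w = cmod u" using that(3) by auto
    ultimately show ?thesis by (simp add: norm_mult norm_divide)
  qed
  note bound = this
  show ?thesis
    unfolding annihilator_def minus_divide_left[symmetric]
    by (rule norm_pair_l2_le[OF c c]; (rule bound)?) (use assms in auto)
qed

text \<open>The exponentials cancel in both components, leaving \<open>\<pi> (1/u - 1/cnj u)\<close>, which depends only on \<open>k\<close>.
  The phase \<open>\<omega> = - \<i> sgn c\<close> is the one for which the pairing becomes positive, so that it
  measures the modulus of \<open>c\<close>.\<close>

lemma inner_exp_pair_annihilator:
  "cscale c (exp_pair u (ev n)) \<bullet> annihilator u (ev n) (- \<i> * sgn c) = 2 * pi / k * cmod c"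
proof -
  let ?p = "\<lambda>w x. c * exp (ev n / w * of_real x)"
  have cp: "continuous_on {0..pi} (?p w)" for w by (intro continuous_intros)
  have c: "continuous_on {0..pi} (\<lambda>x. a * cnj (exp (b * of_real x) / w))" for a b w :: complex
    by (cases "w = 0") (auto intro!: continuous_intros)
  have "cscale c (exp_pair u (ev n)) = abs_l2 (\<lambda>x. vector [?p u x, ?p (cnj u) x])"
    by (simp only: exp_pair_def cscale_pair[OF continuous_exp continuous_exp] pair_l2_def[of "?p u"])
  then have "cscale c (exp_pair u (ev n)) \<bullet> annihilator u (ev n) (- \<i> * sgn c)
    = (LINT x|M0pi. Re (?p u x * cnj (- \<i> * sgn c * cnj (exp (- ev n / u * of_real x) / u)) +
        ?p (cnj u) x * cnj (- (- \<i> * sgn c) * cnj (exp (- ev n / cnj u * of_real x) / cnj u))))"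
    unfolding annihilator_def
    using inner_pair_l2[OF square_integrable_pair[OF cp cp] c c, of u "cnj u"] by (simp only: vector_2)
  also have "\<dots> = (LINT x|M0pi. 2 / k * cmod c)"
  proof (rule Bochner_Integration.integral_cong[OF refl])
    fix x
    have e: "?p w x * cnj (z * cnj (exp (- ev n / w * of_real x) / w)) = c * cnj z * (1 / w)" for w z
      by (simp add: exp_minus)
    have "c * cnj (sgn c) = cmod c"
      by (cases "c = 0") (simp_all add: sgn_eq complex_norm_square[symmetric] power2_eq_square)
    then have "c * cnj (- \<i> * sgn c) = \<i> * cmod c"
      by (simp add: mult.left_commute)
    then have "c * cnj (- \<i> * sgn c) * (1 / u) + c * cnj (- (- \<i> * sgn c)) * (1 / cnj u)
        = of_real (2 / k * cmod c)"
      unfolding inv_cnj_u_diff by (simp add: algebra_simps)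
    then show "Re (?p u x * cnj (- \<i> * sgn c * cnj (exp (- ev n / u * of_real x) / u)) +
        ?p (cnj u) x * cnj (- (- \<i> * sgn c) * cnj (exp (- ev n / cnj u * of_real x) / cnj u))) = 2 / k * cmod c"
      unfolding e by (simp only: Re_complex_of_real)
  qed
  also have "\<dots> = pi * (2 / k * cmod c) - 0 * (2 / k * cmod c)"
    using k by (intro integral_M0pi_FTC)
      (auto simp: has_real_derivative_iff_has_vector_derivative[symmetric] intro!: derivative_eq_intros)
  finally show ?thesis by simp
qed

text \<open>Both components of the eigenfunction \<open>e\<close> grow exponentially from 0 to \<open>\<pi>\<close>, so a correction placed
  near 0 suffices to move \<open>e\<close> into the range of \<open>L\<^sub>u - k n\<close> at little cost. Solving
  \<open>(L\<^sub>u - k n) f = e\<close> by variation of constants gives \<open>f = (x/u e\<^sub>1, x/cnj u e\<^sub>2)\<close>, which violates only the boundary condition at \<open>\<pi>\<close>,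
  by a multiple of \<open>2 \<i> \<pi>/k\<close>. The defect is repaired by a profile \<open>R\<close> rising from 0 to 1, at the cost of
  an error term proportional to \<open>R' e\<^sub>1\<close>. The optimal rise takes place near 0, where \<open>e\<^sub>1\<close> is small:
  \<open>R'\<close> is proportional to \<open>exp (- 2 n r x)\<close>. The error then grows only linearly in \<open>n\<close>, whereas \<open>e\<close> grows exponentially.\<close>

lemma exp_pair_near_range:
  assumes "r > 0" "n > 0"
  obtains f w where "(f, (exp_pair u (ev n) + w) + cscale (ev n) f) \<in> L_op u"
    "norm w \<le> sqrt (2 * pi) * (cmod u * (2 * pi / k) * (2 * real n * r / (1 - exp (- (2 * r * pi)))))"
proof -
  define D where "D = 1 - exp (- (2 * real n * r * pi))"
  have D: "D \<ge> 1 - exp (- (2 * r * pi))" "1 - exp (- (2 * r * pi)) > 0"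
    using assms by (simp_all add: D_def)
  then have D0: "D > 0" by linarith
  define R where "R x = (1 - exp (- (2 * real n * r * x))) / D" for x
  define R' where "R' x = 2 * real n * r * exp (- (2 * real n * r * x)) / D" for x
  have R: "(R has_real_derivative R' x) (at x)" for x
    unfolding R_def R'_def using D0 by (auto intro!: derivative_eq_intros)
  have R_ends: "R 0 = 0" "R pi = 1" using D0 by (simp_all add: R_def D_def[symmetric])
  have cR: "continuous_on S R" for S
    using R by (intro continuous_at_imp_continuous_on ballI) (rule DERIV_isCont)
  have cR': "continuous_on S R'" for S
    unfolding R'_def using D0 by (intro continuous_intros) auto
  define a where "a = 2 * \<i> * pi / k"
  let ?e = "\<lambda>x. exp (ev n / u * of_real x)" and ?e' = "\<lambda>x. exp (ev n / cnj u * of_real x)"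
  define p where "p x = (of_real x / u + a * of_real (R x)) * ?e x" for x
  define q where "q x = of_real x / cnj u * ?e' x" for x
  define p' where "p' x = (of_real x / u + a * of_real (R x)) * (ev n / u * ?e x) + (1 / u + a * of_real (R' x)) * ?e x" for x
  define q' where "q' x = of_real x / cnj u * (ev n / cnj u * ?e' x) + 1 / cnj u * ?e' x" for x
  have lin: "((\<lambda>x. of_real x / w) has_vector_derivative 1 / w) (at x)" if "w \<noteq> 0" for w :: complex and x
    by (rule has_vector_derivative_eq_rhs[OF has_vector_derivative_real_field])
      (use that in \<open>auto intro!: derivative_eq_intros\<close>)
  have Rc: "((\<lambda>x. a * of_real (R x)) has_vector_derivative a * of_real (R' x)) (at x)" for x
    using R[of x] by (auto simp: has_real_derivative_iff_has_vector_derivative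
        intro!: has_vector_derivative_mult_right has_vector_derivative_of_real)
  have dp: "(p has_vector_derivative p' x) (at x)" for x
    unfolding p_def p'_def
    by (rule has_vector_derivative_mult[OF has_vector_derivative_add[OF lin[OF u_nz] Rc] exp_has_vector_derivative])
  have dq: "(q has_vector_derivative q' x) (at x)" for x
    unfolding q_def q'_def
    by (rule has_vector_derivative_mult[OF lin exp_has_vector_derivative]) (simp add: u_nz)
  have cont: "continuous_on {0..pi} p" "continuous_on {0..pi} q"
    using dp dq by (auto intro!: continuous_at_imp_continuous_on has_vector_derivative_continuous)
  have cont': "continuous_on {0..pi} p'" "continuous_on {0..pi} q'"
    unfolding p'_def q'_def using u_nz by (auto intro!: continuous_intros cR cR')
  have ends: "p 0 = q 0" "p pi = q pi"
  proof -
    show "p 0 = q 0" by (simp add: p_def q_def R_ends)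
    have "pi / cnj u = pi * (1 / cnj u)" by simp
    also have "\<dots> = pi / u + a" unfolding inv_cnj_u_diff a_def by (simp add: algebra_simps)
    finally show "p pi = q pi" by (simp add: p_def q_def R_ends exp_ev_pi[simplified])
  qed
  define w where "w = pair_l2 (\<lambda>x. u * a * of_real (R' x) * ?e x) (\<lambda>x. 0)"
  have cw: "continuous_on {0..pi} (\<lambda>x. u * a * of_real (R' x) * ?e x)"
    by (intro continuous_intros cR')
  have "(pair_l2 p q, pair_l2 (\<lambda>x. u * p' x) (\<lambda>x. cnj u * q' x)) \<in> L_op u"
    by (rule L_op_pairI[OF dp dq cont' ends])
  also have "pair_l2 (\<lambda>x. u * p' x) (\<lambda>x. cnj u * q' x) =
      (exp_pair u (ev n) + w) + cscale (ev n) (pair_l2 p q)"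
  proof -
    have "(exp_pair u (ev n) + w) + cscale (ev n) (pair_l2 p q) =
      pair_l2 (\<lambda>x. ?e x + u * a * of_real (R' x) * ?e x + ev n * p x) (\<lambda>x. ?e' x + 0 + ev n * q x)"
      unfolding exp_pair_def w_def cscale_pair[OF cont] add_pair[OF continuous_exp continuous_exp cw continuous_on_const]
      by (rule add_pair) (intro continuous_intros cR' cont)+
    moreover have "u * p' x = ?e x + u * a * of_real (R' x) * ?e x + ev n * p x" for x
      using u_nz by (simp add: p_def p'_def field_simps)
    moreover have "cnj u * q' x = ?e' x + 0 + ev n * q x" for x
      using u_nz by (simp add: q_def q'_def field_simps)
    ultimately show ?thesis by simp
  qed
  finally have "(pair_l2 p q, (exp_pair u (ev n) + w) + cscale (ev n) (pair_l2 p q)) \<in> L_op u" .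
  moreover have "norm w \<le> sqrt (2 * pi) * (cmod u * (2 * pi / k) * (2 * real n * r / (1 - exp (- (2 * r * pi)))))"
    unfolding w_def
  proof (rule norm_pair_l2_le[OF cw continuous_on_const])
    let ?B = "cmod u * (2 * pi / k) * (2 * real n * r / (1 - exp (- (2 * r * pi))))"
    show B: "?B \<ge> 0" using k r D by simp
    then show "cmod 0 \<le> ?B" by simp
    fix x :: real assume x: "0 < x" "x < pi"
    have "cmod (u * a * of_real (R' x) * ?e x) = cmod u * (2 * pi / k) * (R' x * exp (real n * r * x))"
      using k r D0 by (simp only: norm_mult cmod_exp_ev) (simp add: a_def norm_mult norm_divide R'_def)
    also have "R' x * exp (real n * r * x) = 2 * real n * r / D * (exp (- (2 * real n * r * x)) * exp (real n * r * x))"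
      by (simp add: R'_def)
    also have "exp (- (2 * real n * r * x)) * exp (real n * r * x) = exp (- (real n * r * x))"
      by (simp add: exp_add[symmetric])
    also have "cmod u * (2 * pi / k) * (2 * real n * r / D * exp (- (real n * r * x))) \<le>
        cmod u * (2 * pi / k) * (2 * real n * r / (1 - exp (- (2 * r * pi))) * 1)"
      using k r D D0 x by (intro mult_left_mono mult_mono divide_left_mono) auto
    finally show "cmod (u * a * of_real (R' x) * ?e x) \<le> ?B" by simp
  qed
  ultimately show ?thesis by (rule that)
qed

end

lemma similar_ops_sym:
  assumes "similar_ops L L'"
  shows "similar_ops L' L"
proof -
  obtain T S where TS: "bounded_clinear T" "bounded_clinear S" "S \<circ> T = id" "T \<circ> S = id"
    "L' = {(g, T h) | g h. (S g, h) \<in> L}"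
    using assms by (auto simp: similar_ops_def)
  have inv: "S (T x) = x" "T (S x) = x" for x
    using TS(3,4) by (simp_all add: fun_eq_iff)
  have "L = {(g, S h) | g h. (T g, h) \<in> L'}"
  proof (intro equalityI subsetI)
    fix z assume "z \<in> L"
    then have "(T (fst z), T (snd z)) \<in> L'" unfolding TS(5) by (auto simp: inv)
    then have "(fst z, S (T (snd z))) \<in> {(g, S h) | g h. (T g, h) \<in> L'}" by blast
    then show "z \<in> {(g, S h) | g h. (T g, h) \<in> L'}" by (simp add: inv)
  next
    fix z assume "z \<in> {(g, S h) | g h. (T g, h) \<in> L'}"
    then show "z \<in> L" unfolding TS(5) by (auto simp: inv)
  qed
  then show ?thesis unfolding similar_ops_def using TS by blast
qed

text \<open>Let \<open>T\<close>, with inverse \<open>S\<close>, transform \<open>L\<^sub>u\<close> into \<open>L\<^sub>u\<^sub>'\<close>. Pull the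
  eigenfunction \<open>e'\<close> of the second operator back to an eigenvector \<open>S e' = c e\<close> of the first.
  As \<open>e'\<close> is near the range of \<open>L\<^sub>u\<^sub>' - k n\<close>, so is \<open>c e\<close> near the range of \<open>L\<^sub>u - k n\<close>, and the
  annihilator bounds \<open>c\<close> by the size of the error, which is \<open>O(n)\<close>.
  Applying \<open>T\<close> turns this into a bound for \<open>e'\<close>.\<close>

lemma exp_pair_norm_growth:
  assumes "eigen_parameter k r u" "eigen_parameter k r' u'" "r' > 0"
    and "similar_ops (L_op u) (L_op u')"
  obtains A where "\<And>n. n > 0 \<Longrightarrow>
    norm (exp_pair u' (of_real (k * real n))) \<le> A * real n * norm (exp_pair u (of_real (k * real n)))"
proof -
  interpret U: eigen_parameter k r u by fact
  interpret U': eigen_parameter k r' u' by fact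
  obtain T S where TS: "bounded_clinear T" "bounded_clinear S" "S \<circ> T = id" "T \<circ> S = id"
    "L_op u' = {(g, T h) | g h. (S g, h) \<in> L_op u}"
    using assms(4) by (auto simp: similar_ops_def)
  have inv: "S (T x) = x" "T (S x) = x" for x
    using TS(3,4) by (simp_all add: fun_eq_iff)
  have S: "bounded_linear S" "\<And>c f. S (cscale c f) = cscale c (S f)"
    and T: "bounded_linear T" "\<And>c f. T (cscale c f) = cscale c (T f)"
    using TS(1,2) by (auto simp: bounded_clinear_def)
  obtain KS where KS: "KS \<ge> 0" "\<And>x. norm (S x) \<le> norm x * KS"
    using bounded_linear.nonneg_bounded[OF S(1)] by blast
  obtain KT where KT: "KT \<ge> 0" "\<And>x. norm (T x) \<le> norm x * KT"
    using bounded_linear.nonneg_bounded[OF T(1)] by blast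
  have pull: "(S g, S h) \<in> L_op u" if "(g, h) \<in> L_op u'" for g h
    using that unfolding TS(5) by (auto simp: inv)
  define W where "W = sqrt (2 * pi) * (cmod u' * (2 * pi / k) * (2 * r' / (1 - exp (- (2 * r' * pi)))))"
  define G where "G = sqrt (2 * pi) * (1 / cmod u)"
  have G0: "G \<ge> 0" by (simp add: G_def)
  show ?thesis
  proof (rule that)
    fix n :: nat assume n: "n > 0"
    let ?\<mu> = "of_real (k * real n) :: complex"
    let ?e = "exp_pair u ?\<mu>" and ?e' = "exp_pair u' ?\<mu>"
    have "(S ?e', cscale ?\<mu> (S ?e')) \<in> L_op u"
      using pull[OF U'.exp_pair_eigen] by (simp only: S)
    from L_op_eigenvector[OF U.u_nz this] obtain c where c: "S ?e' = cscale c ?e"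
      unfolding exp_pair_def by blast
    obtain f w where f: "(f, (?e' + w) + cscale ?\<mu> f) \<in> L_op u'" and w: "norm w \<le> W * real n"
      by (rule U'.exp_pair_near_range[OF assms(3) n]) (auto simp: W_def mult_ac)
    define g where "g = annihilator u ?\<mu> (- \<i> * sgn c)"
    have "(S f, (S ?e' + S w) + cscale ?\<mu> (S f)) \<in> L_op u"
      using pull[OF f] by (simp only: S linear_add[OF bounded_linear.linear[OF S(1)]])
    then have "(S ?e' + S w) \<bullet> g = 0"
      unfolding g_def
      by (rule annihilator_range[OF U.u_nz]) (use U.exp_ev_pi[of n] in \<open>simp add: exp_minus\<close>)
    then have "2 * pi / k * cmod c = - (S w \<bullet> g)"
      unfolding c by (simp only: inner_add_left g_def U.inner_exp_pair_annihilator eq_neg_iff_add_eq_0)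
    also have "\<dots> \<le> norm (S w) * norm g"
      using norm_cauchy_schwarz[of "- S w" g] by simp
    also have "\<dots> \<le> (W * real n * KS) * G"
    proof (rule mult_mono)
      show "norm (S w) \<le> W * real n * KS"
        using KS(2)[of w] mult_right_mono[OF w KS(1)] by linarith
      then show "0 \<le> W * real n * KS" using norm_ge_zero order.trans by blast
      show "norm g \<le> G"
        unfolding g_def G_def by (rule U.norm_annihilator_le) (simp add: norm_mult norm_sgn)
    qed simp
    finally have "cmod c \<le> k / (2 * pi) * ((W * real n * KS) * G)"
      using U.k by (simp add: field_simps)
    then have "cmod c * norm ?e * KT \<le> k / (2 * pi) * ((W * real n * KS) * G) * norm ?e * KT"
      by (intro mult_right_mono KT) auto
    moreover have "norm ?e' \<le> cmod c * norm ?e * KT"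
      using KT(2)[of "S ?e'"] unfolding inv by (simp only: c norm_cscale)
    ultimately show "norm ?e' \<le> (k / (2 * pi) * W * KS * G * KT) * real n * norm ?e"
      by (simp add: mult_ac)
  qed
qed

text \<open>The eigenfunctions have norms of order \<open>exp (n r \<pi>)\<close> and \<open>exp (n r' \<pi>)\<close> up to powers of \<open>n\<close>, so
  for \<open>r < r'\<close> no linear factor in \<open>n\<close> can compare them.\<close>

lemma not_similar_L_op_less:
  assumes U: "eigen_parameter k r u" and U': "eigen_parameter k r' u'" and less: "r < r'"
  shows "\<not> similar_ops (L_op u) (L_op u')"
proof
  interpret U: eigen_parameter k r u by fact
  interpret U': eigen_parameter k r' u' by fact
  assume "similar_ops (L_op u) (L_op u')"
  moreover have r': "r' > 0" using less U.r by linarith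
  ultimately obtain A where A: "\<And>n. n > 0 \<Longrightarrow>
    norm (exp_pair u' (of_real (k * real n))) \<le> A * real n * norm (exp_pair u (of_real (k * real n)))"
    using exp_pair_norm_growth[OF U U'] by blast
  define \<delta> where "\<delta> = 2 * (r' - r) * pi"
  have \<delta>: "\<delta> > 0" using less by (simp add: \<delta>_def)
  define C where "C = r' * (\<bar>A\<bar> * sqrt (2 * pi))\<^sup>2"
  have bound: "exp (\<delta> * real n) \<le> (1 + C) * real n ^ 3" if n: "n > 0" for n
  proof -
    let ?E = "exp (real n * r * pi)"
    have "norm (exp_pair u' (of_real (k * real n))) \<le> \<bar>A\<bar> * real n * norm (exp_pair u (of_real (k * real n)))"
      by (rule order.trans[OF A[OF n]]) (intro mult_right_mono; simp)
    also have "\<dots> \<le> \<bar>A\<bar> * real n * (sqrt (2 * pi) * ?E)"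
      by (intro mult_left_mono U.norm_exp_pair_le) simp
    finally have "(norm (exp_pair u' (of_real (k * real n))))\<^sup>2 \<le> (\<bar>A\<bar> * real n * (sqrt (2 * pi) * ?E))\<^sup>2"
      by (rule power_mono) simp
    also have "\<dots> = (\<bar>A\<bar> * sqrt (2 * pi))\<^sup>2 * (real n)\<^sup>2 * ?E\<^sup>2"
      by (simp only: power_mult_distrib mult_ac)
    finally have "(exp (2 * real n * r' * pi) - 1) / (real n * r') \<le> (\<bar>A\<bar> * sqrt (2 * pi))\<^sup>2 * (real n)\<^sup>2 * ?E\<^sup>2"
      unfolding U'.norm_exp_pair[OF r' n] .
    then have "exp (2 * real n * r' * pi) - 1 \<le> (\<bar>A\<bar> * sqrt (2 * pi))\<^sup>2 * (real n)\<^sup>2 * ?E\<^sup>2 * (real n * r')"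
      using n r' by (simp add: pos_divide_le_eq)
    also have "\<dots> = C * real n ^ 3 * ?E\<^sup>2"
      by (simp add: C_def power2_eq_square power3_eq_cube mult_ac)
    finally have "exp (2 * real n * r' * pi) \<le> 1 + C * real n ^ 3 * ?E\<^sup>2" by simp
    also have "\<dots> \<le> real n ^ 3 * ?E\<^sup>2 + C * real n ^ 3 * ?E\<^sup>2"
    proof -
      have "1 \<le> real n ^ 3" using n by (intro one_le_power) simp
      moreover have "1 \<le> ?E\<^sup>2" using U.r by (intro one_le_power) simp
      ultimately have "1 * 1 \<le> real n ^ 3 * ?E\<^sup>2" by (intro mult_mono) auto
      then show ?thesis by simp
    qed
    also have "\<dots> = (1 + C) * real n ^ 3 * ?E\<^sup>2" by (simp add: algebra_simps)
    also have "exp (2 * real n * r' * pi) = exp (\<delta> * real n) * ?E\<^sup>2"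
      by (simp add: \<delta>_def power2_eq_square exp_add[symmetric] algebra_simps)
    finally show ?thesis by simp
  qed
  have "(\<lambda>n. (1 + C) * (real n ^ 3 / exp (\<delta> * real n))) \<longlonglongrightarrow> (1 + C) * 0"
    using \<delta> by (intro tendsto_mult tendsto_const) real_asymp
  then have "eventually (\<lambda>n. (1 + C) * (real n ^ 3 / exp (\<delta> * real n)) < 1) sequentially"
    by (rule order_tendstoD(2)) simp
  then have "eventually (\<lambda>n. False) sequentially"
    using eventually_gt_at_top[of 0]
  proof eventually_elim
    case (elim n)
    with bound[of n] show ?case by (simp add: field_simps)
  qed
  then show False by simp
qed

lemma eigen_parameter_circle:
  assumes "k > 0" "Re u \<ge> 0" "Im u > 0" "(Re u)\<^sup>2 + (Im u)\<^sup>2 = k * Im u"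
  shows "eigen_parameter k (Re u / Im u) u"
proof
  show "u \<noteq> 0" using assms by auto
  show "1 / u = Complex (Re u / Im u) (- 1) / complex_of_real k"
    using assms(1,3) by (simp add: complex_eq_iff Re_divide Im_divide assms(4)[unfolded power2_eq_square] power2_eq_square)
qed (use assms in auto)

theorem theorem36:
  fixes k :: real and u u' :: complex
  assumes "k > 0"
    and "Re u \<ge> 0" and "Im u > 0" and "(Re u)\<^sup>2 + (Im u)\<^sup>2 = k * Im u"
    and "Re u' \<ge> 0" and "Im u' > 0" and "(Re u')\<^sup>2 + (Im u')\<^sup>2 = k * Im u'"
    and "u \<noteq> u'"
  shows "\<not> similar_ops (L_op u) (L_op u')"
proof -
  have U: "eigen_parameter k (Re u / Im u) u" and U': "eigen_parameter k (Re u' / Im u') u'"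
    using assms by (auto intro: eigen_parameter_circle)
  have "Re u / Im u \<noteq> Re u' / Im u'"
  proof
    assume "Re u / Im u = Re u' / Im u'"
    then have "1 / u = 1 / u'"
      using eigen_parameter.inv_u[OF U] eigen_parameter.inv_u[OF U'] by simp
    with \<open>u \<noteq> u'\<close> show False by simp
  qed
  then consider "Re u / Im u < Re u' / Im u'" | "Re u' / Im u' < Re u / Im u" by linarith
  then show ?thesis
  proof cases
    case 1
    then show ?thesis by (rule not_similar_L_op_less[OF U U'])
  next
    case 2
    then have "\<not> similar_ops (L_op u') (L_op u)" by (rule not_similar_L_op_less[OF U' U])
    then show ?thesis using similar_ops_sym by blast
  qed
qed

end
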